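(* Suppose Assumption A (constant $d$), Assumption E (constants $C_\lambda,L_\lambda$) and Assumption O (constant $\kappa^\circ$) hold. If in addition $(\log G_\epsilon)/m^\circ_\epsilon\to0$ as $\epsilon\to0$, then with $D^\circ:=\lceil5L_\lambda/\kappa^\circ\rceil$ and $K^\circ:=10\big((1+1/d)\vee\|\theta^\circ-\eta\|^2/d^2\big)L_\lambda^2\big(8C_\lambda(1+1/d)\vee D^\circ\Lambda_{(D^\circ)}\big)$, $$\lim_{\epsilon\to0}\mathbb E_{\theta^\circ}P_{\vartheta^M|Y}\Big((K^\circ)^{-1}\Phi^\circ_\epsilon\le\|\vartheta^M-\theta^\circ\|^2\le K^\circ\Phi^\circ_\epsilon\Big)=1.$$
   Context: Let $\ell^2$ be the space of square-summable real sequences with norm $\|\cdot\|$. Fix a bounded real sequence $\lambda=(\lambda_j)_{j\ge1}$ with $\lambda_j\ne0$ for all $j$, a noise level $\epsilon\in(0,1)$ and a true parameter $\theta^\circ\in\ell^2$. The data $Y=(Y_j)_{j\ge1}$ satisfy $Y_j=\lambda_j\theta^\circ_j+\sqrt\epsilon\,\xi_j$ with $\xi_j$ i.i.d. $N(0,1)$; $\mathbb E_{\theta^\circ}$ denotes expectation under this law. Fix prior means $\eta=(\eta_j)_{j\ge1}$ with $\theta^\circ-\eta\in\ell^2$ and prior variances $\tau_j\in(0,\infty)$ (possibly depending on $\epsilon$). For $m\in\mathbb N$ the sieve prior is the law of $\vartheta^m$ with independent coordinates, $\vartheta^m_j\sim N(\eta_j,\tau_j)$ for $j\le m$ and $\vartheta^m_j=\eta_j$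 a.s. for $j>m$; put $\sigma_j:=(\lambda_j^2\epsilon^{-1}+\tau_j^{-1})^{-1}$, $\theta^Y_j:=\sigma_j(\tau_j^{-1}\eta_j+\lambda_j\epsilon^{-1}Y_j)$; the posterior $P_{\vartheta^m|Y}$ makes the coordinates independent with $\vartheta^m_j\sim N(\theta^Y_j,\sigma_j)$ for $j\le m$ and $\vartheta^m_j=\eta_j$ for $j>m$; $\hat\theta^m_j:=\theta^Y_j$ for $j\le m$, $\hat\theta^m_j:=\eta_j$ for $j>m$. Define $b_m:=\sum_{j>m}(\theta^\circ_j-\eta_j)^2$, $\Lambda_j:=\lambda_j^{-2}$, $\Lambda_{(m)}:=\max_{1\le j\le m}\Lambda_j$, $\bar\Lambda_m:=m^{-1}\sum_{j=1}^m\Lambda_j$, $\Phi^m_\epsilon:=b_m\vee\epsilon m\bar\Lambda_m$, $m^\circ_\epsilon:=\min\{m\ge1:\Phi^m_\epsilon\le\Phi^k_\epsilon\ \forall k\ge1\}$, $\Phi^\circ_\epsilon:=\min_{m\ge1}\Phi^m_\epsilon$. Let $G_\epsilon:=\max\{1\le m\le\lfloor\epsilon^{-1}\rfloor:\epsilon\Lambda_{(m)}\le\Lambda_1\}$. Assumption A: there is $d>0$ with $\tau_j\ge d\,(\epsilon^{1/2}\Lambda_j^{1/2}\vee\epsilon\Lambda_j)$ for all $1\le j\le G_\epsilon$, $\epsilon\in(0,1)$. Assumption E: there are constants $C_\lambda\ge1$, $L_\lambda\ge1$ such that for all $k,l\in\mathbb N$: (i) $\sup_{j>k}\lambda_j^2\le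 C_\lambda\min_{1\le j\le k}\lambda_j^2=C_\lambda\Lambda_{(k)}^{-1}$; (ii) $\Lambda_{(kl)}\le\Lambda_{(k)}\Lambda_{(l)}$; (iii) $\Lambda_{(k)}/\bar\Lambda_k\le L_\lambda$. Fix $\epsilon_o\in(0,1)$. Assumption O: $\kappa^\circ:=\inf_{0<\epsilon<\epsilon_o}(\Phi^\circ_\epsilon)^{-1}[b_{m^\circ_\epsilon}\wedge\epsilon m^\circ_\epsilon\bar\Lambda_{m^\circ_\epsilon}]>0$. Hierarchical prior: a random dimension $M$ with values in $\{1,\dots,G_\epsilon\}$ and $P(M=m)\propto\exp(-3C_\lambda m/2)\prod_{j=1}^m(\tau_j/\sigma_j)^{1/2}$; conditionally on $M=m$ the parameter $\vartheta^M$ has the law of $\vartheta^m$, and $Y_j=\lambda_j\vartheta^M_j+\sqrt\epsilon\xi_j$. The posterior of $M$ is $P_{M|Y}(M=m)=\exp(\frac12\{\|\hat\theta^m-\eta\|_\sigma^2-3C_\lambda m\})/\sum_{k=1}^{G_\epsilon}\exp(\frac12\{\|\hat\theta^k-\eta\|_\sigma^2-3C_\lambda k\})$ with $\|x\|_\sigma^2:=\sum_j x_j^2/\sigma_j$, and the posterior of $\vartheta^M$ is the mixture $P_{\vartheta^M|Y}=\sum_{m=1}^{G_\epsilon}P_{M|Y}(M=m)\,P_{\vartheta^m|Y}$. *)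

theory Defs
  imports "HOL-Probability.Probability"
begin

(* Sequences are indexed from 1; the value at index 0 is never used. *)

definition Lam :: "(nat \<Rightarrow> real) \<Rightarrow> nat \<Rightarrow> real" where
  "Lam lam j = 1 / (lam j)^2"

definition Lmax :: "(nat \<Rightarrow> real) \<Rightarrow> nat \<Rightarrow> real" where
  "Lmax lam m = Max (Lam lam ` {1..m})"

definition Lbar :: "(nat \<Rightarrow> real) \<Rightarrow> nat \<Rightarrow> real" where
  "Lbar lam m = (\<Sum>j=1..m. Lam lam j) / real m"

definition sqnorm :: "(nat \<Rightarrow> real) \<Rightarrow> real" where
  "sqnorm x = (\<Sum>j. (x (Suc j))^2)"

definition bias :: "(nat \<Rightarrow> real) \<Rightarrow> (nat \<Rightarrow> real) \<Rightarrow> nat \<Rightarrow> real" where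
  "bias theta eta m = (\<Sum>i. (theta (i + Suc m) - eta (i + Suc m))^2)"

definition Phi :: "(nat \<Rightarrow> real) \<Rightarrow> (nat \<Rightarrow> real) \<Rightarrow> (nat \<Rightarrow> real) \<Rightarrow> real \<Rightarrow> nat \<Rightarrow> real" where
  "Phi lam theta eta eps m = max (bias theta eta m) (eps * real m * Lbar lam m)"

definition mo :: "(nat \<Rightarrow> real) \<Rightarrow> (nat \<Rightarrow> real) \<Rightarrow> (nat \<Rightarrow> real) \<Rightarrow> real \<Rightarrow> nat" where
  "mo lam theta eta eps =
     (LEAST m. 1 \<le> m \<and> (\<forall>k\<ge>1. Phi lam theta eta eps m \<le> Phi lam theta eta eps k))"

definition Phio :: "(nat \<Rightarrow> real) \<Rightarrow> (nat \<Rightarrow> real) \<Rightarrow> (nat \<Rightarrow> real) \<Rightarrow> real \<Rightarrow> real" where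
  "Phio lam theta eta eps = (INF m\<in>{1..}. Phi lam theta eta eps m)"

definition Gdim :: "(nat \<Rightarrow> real) \<Rightarrow> real \<Rightarrow> nat" where
  "Gdim lam eps = Max {m. 1 \<le> m \<and> m \<le> nat \<lfloor>1 / eps\<rfloor> \<and> eps * Lmax lam m \<le> Lam lam 1}"

definition kappa_o :: "(nat \<Rightarrow> real) \<Rightarrow> (nat \<Rightarrow> real) \<Rightarrow> (nat \<Rightarrow> real) \<Rightarrow> real \<Rightarrow> real" where
  "kappa_o lam theta eta eps_o =
     (INF eps\<in>{0<..<eps_o}.
        min (bias theta eta (mo lam theta eta eps))
            (eps * real (mo lam theta eta eps) * Lbar lam (mo lam theta eta eps))
        / Phio lam theta eta eps)"

definition Do :: "(nat \<Rightarrow> real) \<Rightarrow> (nat \<Rightarrow> real) \<Rightarrow> (nat \<Rightarrow> real) \<Rightarrow> real \<Rightarrow> real \<Rightarrow> nat" where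
  "Do lam theta eta eps_o L = nat \<lceil>5 * L / kappa_o lam theta eta eps_o\<rceil>"

definition Ko :: "(nat \<Rightarrow> real) \<Rightarrow> (nat \<Rightarrow> real) \<Rightarrow> (nat \<Rightarrow> real) \<Rightarrow> real \<Rightarrow> real \<Rightarrow> real \<Rightarrow> real \<Rightarrow> real" where
  "Ko lam theta eta eps_o d C L =
     10 * max (1 + 1/d) (sqnorm (\<lambda>j. theta j - eta j) / d^2) * L^2
        * max (8 * C * (1 + 1/d))
              (real (Do lam theta eta eps_o L) * Lmax lam (Do lam theta eta eps_o L))"

(* posterior quantities; tau here is the variance sequence at the given eps *)
definition sig :: "(nat \<Rightarrow> real) \<Rightarrow> (nat \<Rightarrow> real) \<Rightarrow> real \<Rightarrow> nat \<Rightarrow> real" where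
  "sig lam tau eps j = 1 / ((lam j)^2 / eps + 1 / tau j)"

definition thetaY :: "(nat \<Rightarrow> real) \<Rightarrow> (nat \<Rightarrow> real) \<Rightarrow> (nat \<Rightarrow> real) \<Rightarrow> real
    \<Rightarrow> (nat \<Rightarrow> real) \<Rightarrow> nat \<Rightarrow> real" where
  "thetaY lam eta tau eps Y j = sig lam tau eps j * (eta j / tau j + lam j * Y j / eps)"

definition sieve_post :: "(nat \<Rightarrow> real) \<Rightarrow> (nat \<Rightarrow> real) \<Rightarrow> (nat \<Rightarrow> real) \<Rightarrow> real
    \<Rightarrow> nat \<Rightarrow> (nat \<Rightarrow> real) \<Rightarrow> (nat \<Rightarrow> real) measure" where
  "sieve_post lam eta tau eps m Y =
     PiM UNIV (\<lambda>j. if 1 \<le> j \<and> j \<le> m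
                    then density lborel (normal_density (thetaY lam eta tau eps Y j) (sqrt (sig lam tau eps j)))
                    else return borel (eta j))"

definition post_exponent :: "(nat \<Rightarrow> real) \<Rightarrow> (nat \<Rightarrow> real) \<Rightarrow> (nat \<Rightarrow> real) \<Rightarrow> real \<Rightarrow> real
    \<Rightarrow> nat \<Rightarrow> (nat \<Rightarrow> real) \<Rightarrow> real" where
  "post_exponent lam eta tau eps C m Y =
     ((\<Sum>j=1..m. (thetaY lam eta tau eps Y j - eta j)^2 / sig lam tau eps j) - 3 * C * real m) / 2"

definition postM :: "(nat \<Rightarrow> real) \<Rightarrow> (nat \<Rightarrow> real) \<Rightarrow> (nat \<Rightarrow> real) \<Rightarrow> real \<Rightarrow> real
    \<Rightarrow> nat \<Rightarrow> (nat \<Rightarrow> real) \<Rightarrow> real" where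
  "postM lam eta tau eps C m Y =
     exp (post_exponent lam eta tau eps C m Y)
     / (\<Sum>k=1..Gdim lam eps. exp (post_exponent lam eta tau eps C k Y))"

definition hier_post_prob :: "(nat \<Rightarrow> real) \<Rightarrow> (nat \<Rightarrow> real) \<Rightarrow> (nat \<Rightarrow> real) \<Rightarrow> real \<Rightarrow> real
    \<Rightarrow> (nat \<Rightarrow> real) \<Rightarrow> (nat \<Rightarrow> real) set \<Rightarrow> real" where
  "hier_post_prob lam eta tau eps C Y A =
     (\<Sum>m=1..Gdim lam eps. postM lam eta tau eps C m Y * measure (sieve_post lam eta tau eps m Y) A)"

definition data_law :: "(nat \<Rightarrow> real) \<Rightarrow> (nat \<Rightarrow> real) \<Rightarrow> real \<Rightarrow> (nat \<Rightarrow> real) measure" where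
  "data_law lam theta eps =
     PiM UNIV (\<lambda>j. density lborel (normal_density (lam j * theta j) (sqrt eps)))"

end

theory Submission
  imports Defs
begin

text \<open>
  Write the data and the posterior draws as affine images of white noise \<open>z\<close> and \<open>w\<close>. The posterior
  exponent becomes \<open>(\<Sum>j\<le>m. a j * (u j + z j)\<^sup>2 - 3 * C * m) / 2\<close> with
  \<open>a j = 1 / (1 + eps * Lam j / tau j)\<close> between \<open>1 / (1 + 1/d)\<close> and 1, and
  \<open>u j = lam j * (theta j - eta j) / sqrt eps\<close>. Since \<open>P(M = m | Y)\<close> is at most 1 and at most the ratio of
  its weight to that of the oracle dimension \<open>m0\<close>, explicit Gaussian integrals bound its mean by
  \<open>exp (- m0 / 5)\<close> whenever \<open>m > D * m0\<close>, or \<open>m < m0\<close> and the bias at \<open>m\<close> exceeds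
  \<open>8 * L * C * (1 + 1/d)\<close> times the oracle rate. There are at most \<open>G\<close> such dimensions, and
  \<open>G * exp (- m0 / 5)\<close> vanishes because \<open>ln G / m0\<close> does. For the remaining dimensions, the upper bound
  on the loss follows from chi-square tails with \<open>D * m0\<close> degrees of freedom for \<open>z\<close> and \<open>w\<close>, and the
  lower bound from a Gaussian small-ball estimate. Finally \<open>m0\<close> tends to infinity because \<open>G\<close> does.
\<close>

section \<open>Gaussian white noise\<close>

definition std_gauss :: "real measure" where
  "std_gauss = density lborel (normal_density 0 1)"

definition white_noise :: "(nat \<Rightarrow> real) measure" where
  "white_noise = PiM UNIV (\<lambda>_. std_gauss)"

lemma prob_space_std_gauss: "prob_space std_gauss"
  unfolding std_gauss_def by (rule prob_space_normal_density) simp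

lemma sets_std_gauss [measurable_cong, simp]: "sets std_gauss = sets borel"
  by (simp add: std_gauss_def)

lemma space_std_gauss [simp]: "space std_gauss = UNIV"
  by (simp add: std_gauss_def)

interpretation white_noise: product_prob_space "\<lambda>_::nat. std_gauss" UNIV
  using prob_space_std_gauss
  by (simp add: product_prob_space_def product_sigma_finite_def product_prob_space_axioms_def
      prob_space_imp_sigma_finite)

lemma prob_space_white_noise: "prob_space white_noise"
  unfolding white_noise_def by unfold_locales

lemma sets_white_noise [measurable_cong, simp]:
  "sets white_noise = sets (PiM UNIV (\<lambda>_. borel))"
  unfolding white_noise_def by (rule sets_PiM_cong) simp_all

lemma space_white_noise [simp]: "space white_noise = UNIV"
  by (simp add: white_noise_def space_PiM)

text \<open>Both measures agree on finite-dimensional cylinders, which determine a product measure.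
  This writes the data law and every sieve posterior as images of
  \<open>white_noise\<close>.\<close>

lemma PiM_distr_white_noise:
  fixes f :: "nat \<Rightarrow> real \<Rightarrow> real"
  assumes f [measurable]: "\<And>j. f j \<in> borel_measurable borel"
  shows "PiM UNIV (\<lambda>j. distr std_gauss borel (f j))
       = distr white_noise (PiM UNIV (\<lambda>_. borel)) (\<lambda>z j. f j (z j))"
proof -
  have ps: "prob_space (distr std_gauss borel (f j))" for j
    by (rule prob_space.prob_space_distr[OF prob_space_std_gauss]) measurable
  interpret Q: product_prob_space "\<lambda>j. distr std_gauss borel (f j)" UNIV
    using ps by (simp add: product_prob_space_def product_sigma_finite_def
        product_prob_space_axioms_def prob_space_imp_sigma_finite)
  have m: "(\<lambda>z j. f j (z j)) \<in> measurable white_noise (PiM UNIV (\<lambda>_. borel))"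
    by (rule measurable_PiM_single') (auto simp: space_PiM)
  show ?thesis
  proof (rule Q.PiM_eq[symmetric])
    show "sets (distr white_noise (PiM UNIV (\<lambda>_. borel)) (\<lambda>z j. f j (z j)))
        = sets (PiM UNIV (\<lambda>j. distr std_gauss borel (f j)))"
      by (simp, rule sets_PiM_cong) simp_all
    fix J :: "nat set" and F
    assume J: "finite J" and F: "\<And>j. j \<in> J \<Longrightarrow> F j \<in> sets (distr std_gauss borel (f j))"
    let ?E = "prod_emb UNIV (\<lambda>j. distr std_gauss borel (f j)) J (Pi\<^sub>E J F)"
    have E: "?E = {x. \<forall>j\<in>J. x j \<in> F j}"
      by (auto simp: prod_emb_def PiE_iff)
    have sE: "?E \<in> sets (PiM UNIV (\<lambda>_. borel))"
      using sets_PiM_I[of J UNIV F "\<lambda>_. borel"] J F by (simp add: prod_emb_def)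
    have "emeasure (distr white_noise (PiM UNIV (\<lambda>_. borel)) (\<lambda>z j. f j (z j))) ?E
        = emeasure white_noise {x. \<forall>j\<in>J. x j \<in> f j -` F j}"
      using sE by (subst emeasure_distr[OF m]) (auto simp: E intro!: arg_cong[where f="emeasure white_noise"])
    also have "\<dots> = (\<Prod>j\<in>J. emeasure std_gauss (f j -` F j))"
      using white_noise.emeasure_PiM_Collect[of J "\<lambda>j. f j -` F j"] J F
        measurable_sets[OF f] by (simp add: white_noise_def space_PiM)
    also have "\<dots> = (\<Prod>j\<in>J. emeasure (distr std_gauss borel (f j)) (F j))"
      using F by (intro prod.cong refl) (simp add: emeasure_distr)
    finally show "emeasure (distr white_noise (PiM UNIV (\<lambda>_. borel)) (\<lambda>z j. f j (z j))) ?E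
        = (\<Prod>j\<in>J. emeasure (distr std_gauss borel (f j)) (F j))" .
  qed
qed

lemma normal_eq_distr_std_gauss:
  assumes "s > 0"
  shows "density lborel (normal_density u s) = distr std_gauss borel (\<lambda>x. u + s * x)"
proof -
  have "distributed std_gauss lborel (\<lambda>x. x) (normal_density 0 1)"
    by (auto simp: distributed_def std_gauss_def intro!: distr_id2)
  from prob_space.normal_density_affine[OF prob_space_std_gauss this, of s u] assms
  have "distributed std_gauss lborel (\<lambda>x. u + s * x) (normal_density u s)" by simp
  then show ?thesis
    unfolding distributed_def by (metis distr_cong sets_lborel)
qed

text \<open>Treats a deterministic coordinate as a constant image of Gaussian noise, so that
  coordinates beyond the sieve dimension fit \<open>PiM_distr_white_noise\<close> too.\<close>

lemma return_eq_distr_std_gauss: "return borel c = distr std_gauss borel (\<lambda>_. c)"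
  using prob_space.distr_const[OF prob_space_std_gauss, of c borel] by simp

section \<open>Exponential moments and tails of Gaussian quadratic forms\<close>

lemma nn_integral_white_noise_prod:
  fixes g :: "nat \<Rightarrow> real \<Rightarrow> ennreal"
  assumes J: "finite J" and g [measurable]: "\<And>j. g j \<in> borel_measurable borel"
  shows "(\<integral>\<^sup>+z. (\<Prod>j\<in>J. g j (z j)) \<partial>white_noise) = (\<Prod>j\<in>J. \<integral>\<^sup>+x. g j x \<partial>std_gauss)"
proof -
  have "(\<integral>\<^sup>+z. (\<Prod>j\<in>J. g j (z j)) \<partial>white_noise)
      = (\<integral>\<^sup>+z. (\<Prod>j\<in>J. g j (restrict z J j)) \<partial>white_noise)"
    by (intro nn_integral_cong prod.cong) auto
  also have "\<dots> = (\<integral>\<^sup>+y. (\<Prod>j\<in>J. g j (y j))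
        \<partial>distr white_noise (PiM J (\<lambda>_. std_gauss)) (\<lambda>x. restrict x J))"
    unfolding white_noise_def by (subst nn_integral_distr) auto
  also have "distr white_noise (PiM J (\<lambda>_. std_gauss)) (\<lambda>x. restrict x J) = PiM J (\<lambda>_. std_gauss)"
    unfolding white_noise_def using white_noise.distr_PiM_restrict_finite[OF J] by simp
  also have "(\<integral>\<^sup>+y. (\<Prod>j\<in>J. g j (y j)) \<partial>PiM J (\<lambda>_. std_gauss))
      = (\<Prod>j\<in>J. \<integral>\<^sup>+x. g j x \<partial>std_gauss)"
    by (rule white_noise.product_nn_integral_prod[OF J]) simp
  finally show ?thesis .
qed

text \<open>Completing the square: the tilted density is a constant times the normal density with
  mean \<open>v\<close> and variance \<open>1 / (1 - 2 * c)\<close>, which integrates to 1.\<close>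

lemma nn_integral_std_gauss_exp_square:
  fixes c u :: real
  assumes c: "c < 1/2"
  shows "(\<integral>\<^sup>+x. ennreal (exp (c * (u + x)\<^sup>2)) \<partial>std_gauss)
       = ennreal (exp (c * u\<^sup>2 / (1 - 2 * c)) / sqrt (1 - 2 * c))"
proof -
  define s where "s = 1 / sqrt (1 - 2 * c)"
  define v where "v = 2 * c * u / (1 - 2 * c)"
  have s: "s > 0" and s2: "s\<^sup>2 = 1 / (1 - 2 * c)"
    using c by (simp_all add: s_def power_divide)
  have q: "c * (u + x)\<^sup>2 - x\<^sup>2 / 2 = c * u\<^sup>2 / (1 - 2 * c) - (x - v)\<^sup>2 / (2 * s\<^sup>2)" for x
  proof -
    define e where "e = 1 - 2 * c"
    have ce: "c = (1 - e) / 2" and e: "e \<noteq> 0" using c by (auto simp: e_def)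
    show ?thesis
      unfolding s2 v_def ce using e by (simp add: field_simps power2_eq_square)
  qed
  have eq: "normal_density 0 1 x * exp (c * (u + x)\<^sup>2)
      = exp (c * u\<^sup>2 / (1 - 2 * c)) / sqrt (1 - 2 * c) * normal_density v s x" for x
  proof -
    have "normal_density 0 1 x * exp (c * (u + x)\<^sup>2)
        = 1 / sqrt (2 * pi) * exp (c * (u + x)\<^sup>2 - x\<^sup>2 / 2)"
      by (simp add: normal_density_def exp_add[symmetric])
    also have "\<dots> = 1 / sqrt (2 * pi) * exp (c * u\<^sup>2 / (1 - 2 * c)) * exp (- (x - v)\<^sup>2 / (2 * s\<^sup>2))"
      unfolding q by (simp add: exp_add[symmetric])
    also have "\<dots> = exp (c * u\<^sup>2 / (1 - 2 * c)) / sqrt (1 - 2 * c) * normal_density v s x"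
      using s by (simp add: normal_density_def real_sqrt_mult) (simp add: s_def)
    finally show ?thesis .
  qed
  have "(\<integral>\<^sup>+x. ennreal (exp (c * (u + x)\<^sup>2)) \<partial>std_gauss)
      = (\<integral>\<^sup>+x. ennreal (normal_density 0 1 x) * ennreal (exp (c * (u + x)\<^sup>2)) \<partial>lborel)"
    unfolding std_gauss_def by (subst nn_integral_density) auto
  also have "\<dots> = (\<integral>\<^sup>+x. ennreal (exp (c * u\<^sup>2 / (1 - 2 * c)) / sqrt (1 - 2 * c))
        * ennreal (normal_density v s x) \<partial>lborel)"
    using c by (intro nn_integral_cong, subst ennreal_mult'[symmetric], simp, subst eq,
        subst ennreal_mult'[symmetric]) auto
  also have "\<dots> = ennreal (exp (c * u\<^sup>2 / (1 - 2 * c)) / sqrt (1 - 2 * c))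
        * (\<integral>\<^sup>+x. ennreal (normal_density v s x) \<partial>lborel)"
    by (rule nn_integral_cmult) simp
  also have "(\<integral>\<^sup>+x. ennreal (normal_density v s x) \<partial>lborel) = 1"
    using s by (subst nn_integral_eq_integral) auto
  finally show ?thesis by simp
qed

text \<open>Independence factorises the moment. The free bounds \<open>b j\<close> let each
  application insert its own estimate of the exact one-coordinate value.\<close>

lemma nn_integral_white_noise_exp_quadratic:
  fixes c u b :: "nat \<Rightarrow> real"
  assumes J: "finite J" and c: "\<And>j. j \<in> J \<Longrightarrow> c j < 1/2"
    and b: "\<And>j. j \<in> J \<Longrightarrow> exp (c j * (u j)\<^sup>2 / (1 - 2 * c j)) / sqrt (1 - 2 * c j) \<le> exp (b j)"
  shows "(\<integral>\<^sup>+z. ennreal (exp (\<Sum>j\<in>J. c j * (u j + z j)\<^sup>2)) \<partial>white_noise) \<le> ennreal (exp (\<Sum>j\<in>J. b j))"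
proof -
  have "(\<integral>\<^sup>+z. ennreal (exp (\<Sum>j\<in>J. c j * (u j + z j)\<^sup>2)) \<partial>white_noise)
      = (\<integral>\<^sup>+z. (\<Prod>j\<in>J. ennreal (exp (c j * (u j + z j)\<^sup>2))) \<partial>white_noise)"
    using J by (intro nn_integral_cong) (simp add: exp_sum prod_ennreal)
  also have "\<dots> = (\<Prod>j\<in>J. \<integral>\<^sup>+x. ennreal (exp (c j * (u j + x)\<^sup>2)) \<partial>std_gauss)"
    by (rule nn_integral_white_noise_prod[OF J]) simp
  also have "\<dots> = (\<Prod>j\<in>J. ennreal (exp (c j * (u j)\<^sup>2 / (1 - 2 * c j)) / sqrt (1 - 2 * c j)))"
    using c by (intro prod.cong refl nn_integral_std_gauss_exp_square) auto
  also have "\<dots> \<le> (\<Prod>j\<in>J. ennreal (exp (b j)))"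
    using b by (intro prod_mono_ennreal ennreal_leI) auto
  also have "\<dots> = ennreal (exp (\<Sum>j\<in>J. b j))"
    using J by (simp add: exp_sum prod_ennreal)
  finally show ?thesis .
qed

text \<open>Exponential Markov inequality. The weights \<open>c j\<close> may be negative, so it
  serves lower tails as well as upper ones.\<close>

lemma white_noise_prob_exp_quadratic_le:
  fixes c u b :: "nat \<Rightarrow> real"
  assumes J: "finite J" and c: "\<And>j. j \<in> J \<Longrightarrow> c j < 1/2"
    and b: "\<And>j. j \<in> J \<Longrightarrow> exp (c j * (u j)\<^sup>2 / (1 - 2 * c j)) / sqrt (1 - 2 * c j) \<le> exp (b j)"
  shows "measure white_noise {z. t \<le> (\<Sum>j\<in>J. c j * (u j + z j)\<^sup>2)} \<le> exp ((\<Sum>j\<in>J. b j) - t)"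
proof -
  interpret W: prob_space white_noise by (rule prob_space_white_noise)
  let ?f = "\<lambda>z. \<Sum>j\<in>J. c j * (u j + z j)\<^sup>2"
  have [measurable]: "?f \<in> borel_measurable white_noise" by measurable
  have "{z \<in> space white_noise. t \<le> ?f z} \<in> sets white_noise" by measurable
  then have [simp]: "{z. t \<le> ?f z} \<in> sets (PiM UNIV (\<lambda>_. borel))" by simp
  have "emeasure white_noise {z. t \<le> ?f z} = (\<integral>\<^sup>+z. indicator {z. t \<le> ?f z} z \<partial>white_noise)"
    by (subst nn_integral_indicator) simp_all
  also have "\<dots> \<le> (\<integral>\<^sup>+z. ennreal (exp (- t)) * ennreal (exp (?f z)) \<partial>white_noise)"
    by (intro nn_integral_mono) (auto simp: indicator_def ennreal_mult'[symmetric] exp_add[symmetric])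
  also have "\<dots> = ennreal (exp (- t)) * (\<integral>\<^sup>+z. ennreal (exp (?f z)) \<partial>white_noise)"
    by (rule nn_integral_cmult) measurable
  also have "\<dots> \<le> ennreal (exp (- t)) * ennreal (exp (\<Sum>j\<in>J. b j))"
    by (intro mult_left_mono nn_integral_white_noise_exp_quadratic assms) auto
  also have "\<dots> = ennreal (exp ((\<Sum>j\<in>J. b j) - t))"
    by (simp add: ennreal_mult'[symmetric] exp_add[symmetric])
  finally show ?thesis
    by (simp add: W.emeasure_eq_measure)
qed

text \<open>Cauchy-Schwarz with weights 1/5, 2/5, 2/5, which sum to 1. The largest coefficient falls
  on the shrinkage bias, the cheapest term in \<open>sqnorm_draw_le\<close>.\<close>

lemma sq_sum3_le:
  fixes p q r :: real
  shows "(p + q + r)\<^sup>2 \<le> 5 * p\<^sup>2 + 5/2 * (q\<^sup>2 + r\<^sup>2)"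
proof -
  have "5 * p\<^sup>2 + 5/2 * (q\<^sup>2 + r\<^sup>2) - (p + q + r)\<^sup>2 = (2 * p - (q + r) / 2)\<^sup>2 + 5/4 * (q - r)\<^sup>2"
    by (simp add: power2_eq_square field_simps)
  moreover have "0 \<le> (2 * p - (q + r) / 2)\<^sup>2 + 5/4 * (q - r)\<^sup>2" by simp
  ultimately show ?thesis by linarith
qed

text \<open>The one-coordinate cost of weight 1/4 is \<open>1 / sqrt (1 - 1/2) = sqrt 2\<close>. The
  value 7/20 lies just above \<open>ln 2 / 2\<close> and below the 3/8 available in
  \<open>chi_square_upper_tail\<close>.\<close>

lemma sqrt_2_le_exp: "sqrt 2 \<le> exp (7/20 :: real)"
proof -
  have "sqrt 2 = exp (ln 2 / 2 :: real)"
    by (simp add: ln_sqrt[symmetric])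
  also have "\<dots> \<le> exp (7/20)" using ln2_le_25_over_36 by simp
  finally show ?thesis .
qed

lemma chi_square_upper_tail:
  "measure white_noise {z. 3/2 * real n \<le> (\<Sum>j=1..n. (z j)\<^sup>2)} \<le> exp (- real n / 40)"
proof -
  have "1 / sqrt (1/2) = sqrt (2::real)" by (simp add: real_sqrt_divide)
  \<comment> \<open>Weight 1/4 scales the threshold 3/2 to 3/8 per coordinate, leaving the exponent
    7/20 - 3/8 = -1/40.\<close>
  then have "measure white_noise {z. 3/8 * real n \<le> (\<Sum>j=1..n. 1/4 * (0 + z j)\<^sup>2)}
      \<le> exp ((\<Sum>j=1..n. 7/20) - 3/8 * real n)"
    using sqrt_2_le_exp by (intro white_noise_prob_exp_quadratic_le) auto
  also have "{z. 3/8 * real n \<le> (\<Sum>j=1..n. 1/4 * (0 + z j)\<^sup>2)}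
      = {z. 3/2 * real n \<le> (\<Sum>j=1..n. (z j :: real)\<^sup>2)}"
    by (auto simp: sum_divide_distrib[symmetric])
  finally show ?thesis by simp
qed

text \<open>A lower tail through negative weights \<open>- s j / (2 * S)\<close>. The centre
  \<open>v\<close> then contributes a non-positive exponent, so the bound is uniform in
  \<open>v\<close>; applied to the posterior it does not depend on the data. The rate is -1/4 + 1/20
  = -1/5.\<close>

lemma gaussian_small_ball:
  fixes v s :: "nat \<Rightarrow> real"
  assumes J: "finite J" and s: "\<And>j. j \<in> J \<Longrightarrow> 0 < s j" "\<And>j. j \<in> J \<Longrightarrow> s j \<le> S" and S: "0 < S"
  shows "measure white_noise {z. (\<Sum>j\<in>J. (v j + sqrt (s j) * z j)\<^sup>2) \<le> (\<Sum>j\<in>J. s j) / 10}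
       \<le> exp (- (\<Sum>j\<in>J. s j) / (5 * S))"
proof -
  let ?c = "\<lambda>j. - s j / (2 * S)" and ?u = "\<lambda>j. v j / sqrt (s j)"
  have "measure white_noise {z. - ((\<Sum>j\<in>J. s j) / 10) / (2 * S) \<le> (\<Sum>j\<in>J. ?c j * (?u j + z j)\<^sup>2)}
     \<le> exp ((\<Sum>j\<in>J. - s j / (4 * S)) - (- ((\<Sum>j\<in>J. s j) / 10) / (2 * S)))"
  proof (rule white_noise_prob_exp_quadratic_le[OF J])
    fix j assume j: "j \<in> J"
    define w where "w = s j / S"
    have w: "0 < w" "w \<le> 1" using s[OF j] S by (auto simp: w_def)
    have c: "?c j = - w / 2" using S by (simp add: w_def field_simps)
    show "?c j < 1/2" unfolding c using w by simp
    \<comment> \<open>On the unit interval \<open>exp (w / 2) \<le> 1 + w\<close>, so the factor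
      \<open>1 / sqrt (1 + w)\<close> is at most \<open>exp (- w / 4)\<close>.\<close>
    have "exp (w / 2) \<le> 1 + w / 2 + (w / 2)\<^sup>2" using w by (intro exp_bound) auto
    also have "\<dots> \<le> 1 + w" using w by (simp add: power2_eq_square field_simps mult_left_le)
    finally have "(exp (w / 4))\<^sup>2 \<le> 1 + w" by (simp flip: exp_double)
    then have h: "exp (w / 4) \<le> sqrt (1 + w)" by (rule real_le_rsqrt)
    have "exp (?c j * (?u j)\<^sup>2 / (1 - 2 * ?c j)) / sqrt (1 - 2 * ?c j) \<le> 1 / sqrt (1 + w)"
      unfolding c using w by (intro divide_mono) (auto simp: field_simps)
    also have "\<dots> \<le> 1 / exp (w / 4)" using h w by (intro divide_left_mono) auto
    also have "\<dots> = exp (- s j / (4 * S))" using S by (simp add: w_def exp_minus field_simps)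
    finally show "exp (?c j * (?u j)\<^sup>2 / (1 - 2 * ?c j)) / sqrt (1 - 2 * ?c j) \<le> exp (- s j / (4 * S))" .
  qed
  also have "(\<Sum>j\<in>J. - s j / (4 * S)) = - (\<Sum>j\<in>J. s j) / (4 * S)"
    by (simp add: sum_divide_distrib sum_negf)
  also have "- (\<Sum>j\<in>J. s j) / (4 * S) - (- ((\<Sum>j\<in>J. s j) / 10) / (2 * S)) = - (\<Sum>j\<in>J. s j) / (5 * S)"
    using S by (simp add: field_simps)
  also have "{z. - ((\<Sum>j\<in>J. s j) / 10) / (2 * S) \<le> (\<Sum>j\<in>J. ?c j * (?u j + z j)\<^sup>2)}
     = {z. (\<Sum>j\<in>J. (v j + sqrt (s j) * z j)\<^sup>2) \<le> (\<Sum>j\<in>J. s j) / 10}"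
  proof -
    have "(\<Sum>j\<in>J. ?c j * (?u j + z j)\<^sup>2) = - (\<Sum>j\<in>J. (v j + sqrt (s j) * z j)\<^sup>2) / (2 * S)" for z
    proof -
      have "?c j * (?u j + z j)\<^sup>2 = - (v j + sqrt (s j) * z j)\<^sup>2 / (2 * S)" if "j \<in> J" for j
      proof -
        have "s j * (?u j + z j)\<^sup>2 = (sqrt (s j) * (?u j + z j))\<^sup>2"
          using s(1)[OF that] by (simp add: power_mult_distrib)
        also have "sqrt (s j) * (?u j + z j) = v j + sqrt (s j) * z j"
          using s(1)[OF that] by (simp add: distrib_left)
        finally show ?thesis by simp
      qed
      then have "(\<Sum>j\<in>J. ?c j * (?u j + z j)\<^sup>2) = (\<Sum>j\<in>J. - (v j + sqrt (s j) * z j)\<^sup>2 / (2 * S))"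
        by (intro sum.cong refl)
      then show ?thesis by (simp add: sum_divide_distrib sum_negf)
    qed
    then show ?thesis using S by (simp only:) (simp add: field_simps)
  qed
  finally show ?thesis .
qed

section \<open>The sieve posterior at a fixed noise level\<close>

locale sequence_model =
  fixes lam eta theta :: "nat \<Rightarrow> real" and C L :: real
  assumes lam_nonzero: "j \<ge> 1 \<Longrightarrow> lam j \<noteq> 0"
    and diff_l2: "summable (\<lambda>j. (theta (Suc j) - eta (Suc j))\<^sup>2)"
    and C_ge_1: "1 \<le> C" and L_ge_1: "1 \<le> L"
    and lam_sq_le: "1 \<le> k \<Longrightarrow> k < j \<Longrightarrow> (lam j)\<^sup>2 \<le> C / Lmax lam k"
    and Lmax_mult_le: "1 \<le> k \<Longrightarrow> 1 \<le> l \<Longrightarrow> Lmax lam (k * l) \<le> Lmax lam k * Lmax lam l"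
    and Lmax_div_Lbar_le: "1 \<le> k \<Longrightarrow> Lmax lam k / Lbar lam k \<le> L"
begin

lemma Lam_pos: "1 \<le> j \<Longrightarrow> 0 < Lam lam j"
  using lam_nonzero by (simp add: Lam_def)

lemma Lam_le_Lmax: "1 \<le> j \<Longrightarrow> j \<le> n \<Longrightarrow> Lam lam j \<le> Lmax lam n"
  unfolding Lmax_def by (intro Max_ge) auto

lemma Lmax_1 [simp]: "Lmax lam (Suc 0) = Lam lam (Suc 0)"
  by (simp add: Lmax_def)

text \<open>Submultiplicativity at \<open>k = l = 1\<close> bounds the positive number
  \<open>Lam lam 1\<close> by its own square.\<close>

lemma Lmax_ge_1: "1 \<le> n \<Longrightarrow> 1 \<le> Lmax lam n"
proof -
  assume n: "1 \<le> n"
  have "Lam lam 1 * 1 \<le> Lam lam 1 * Lam lam 1"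
    using Lmax_mult_le[of 1 1] by simp
  then have "1 \<le> Lam lam 1" using Lam_pos[of 1] by simp
  also have "\<dots> \<le> Lmax lam n" using n by (intro Lam_le_Lmax) auto
  finally show ?thesis .
qed

lemma real_times_Lbar: "real m * Lbar lam m = (\<Sum>j=1..m. Lam lam j)"
  by (cases "m = 0") (auto simp: Lbar_def)

lemma Lbar_pos: "1 \<le> m \<Longrightarrow> 0 < Lbar lam m"
  unfolding Lbar_def by (intro divide_pos_pos sum_pos) (auto simp: Lam_pos)

lemma Lmax_le_Lbar: "1 \<le> m \<Longrightarrow> Lmax lam m \<le> L * Lbar lam m"
  using Lmax_div_Lbar_le[of m] Lbar_pos[of m] by (simp add: field_simps)

lemma Lbar_le_Lmax: "1 \<le> m \<Longrightarrow> Lbar lam m \<le> Lmax lam m"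
proof -
  assume m: "1 \<le> m"
  have "(\<Sum>j=1..m. Lam lam j) \<le> (\<Sum>j=1..m. Lmax lam m)"
    by (intro sum_mono Lam_le_Lmax) auto
  then show ?thesis using m by (simp add: Lbar_def field_simps)
qed

lemma summable_tail: "summable (\<lambda>i. (theta (i + Suc m) - eta (i + Suc m))\<^sup>2)"
  using summable_ignore_initial_segment[OF diff_l2, of m] by simp

lemma bias_nonneg: "0 \<le> bias theta eta m"
  unfolding bias_def by (intro suminf_nonneg summable_tail) auto

lemma bias_split:
  assumes "m \<le> n"
  shows "bias theta eta m = bias theta eta n + (\<Sum>j=Suc m..n. (theta j - eta j)\<^sup>2)"
proof -
  have "bias theta eta m = (\<Sum>i. (theta (i + (n - m) + Suc m) - eta (i + (n - m) + Suc m))\<^sup>2)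
      + (\<Sum>i<n - m. (theta (i + Suc m) - eta (i + Suc m))\<^sup>2)"
    unfolding bias_def by (rule suminf_split_initial_segment[OF summable_tail])
  also have "(\<Sum>i. (theta (i + (n - m) + Suc m) - eta (i + (n - m) + Suc m))\<^sup>2) = bias theta eta n"
    using assms by (simp add: bias_def)
  also have "(\<Sum>i<n - m. (theta (i + Suc m) - eta (i + Suc m))\<^sup>2) = (\<Sum>j=Suc m..n. (theta j - eta j)\<^sup>2)"
    using assms by (intro sum.reindex_bij_witness[where i="\<lambda>j. j - Suc m" and j="\<lambda>i. i + Suc m"]) auto
  finally show ?thesis .
qed

lemma bias_antimono: "m \<le> n \<Longrightarrow> bias theta eta n \<le> bias theta eta m"
  using bias_split[of m n] by (simp add: sum_nonneg)

lemma partial_sum_le_sqnorm: "(\<Sum>j=1..m. (theta j - eta j)\<^sup>2) \<le> sqnorm (\<lambda>j. theta j - eta j)"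
proof -
  have "sqnorm (\<lambda>j. theta j - eta j) = bias theta eta 0" by (simp add: sqnorm_def bias_def)
  then show ?thesis using bias_split[of 0 m] bias_nonneg[of m] by simp
qed

end

text \<open>One noise level is frozen. \<open>m0\<close>, \<open>Phi0\<close>, \<open>kap\<close>
  and \<open>D\<close> stand for the oracle dimension, the oracle rate, \<open>kappa_o\<close> and
  \<open>Do\<close>. The oracle enters through inequalities only, so that no minimiser, infimum or
  limit appears in the Gaussian estimates.\<close>

locale sieve_model = sequence_model +
  fixes tau :: "nat \<Rightarrow> real" and eps d kap Phi0 :: real and m0 D :: nat
  assumes tau_pos: "j \<ge> 1 \<Longrightarrow> 0 < tau j"
    and eps_pos: "0 < eps" and d_pos: "0 < d"
    and tau_ge: "j \<in> {1..Gdim lam eps} \<Longrightarrow> d * max (sqrt (eps * Lam lam j)) (eps * Lam lam j) \<le> tau j"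
    and m0: "1 \<le> m0" "m0 \<le> Gdim lam eps"
    and kap: "0 < kap" "kap \<le> 1"
    and D_ge: "5 * L / kap \<le> real D"
    and oracle_upper: "bias theta eta m0 \<le> Phi0" "eps * real m0 * Lbar lam m0 \<le> Phi0"
    and oracle_lower: "kap * Phi0 \<le> bias theta eta m0" "kap * Phi0 \<le> eps * real m0 * Lbar lam m0"
begin

text \<open>The weight of the observation in the posterior mean; also the ratio of the posterior
  variance to the variance \<open>eps * Lam lam j\<close> of \<open>Y j / lam j\<close>.\<close>

definition shrink :: "nat \<Rightarrow> real" where
  "shrink j = 1 / (1 + eps * Lam lam j / tau j)"

text \<open>The offset from the prior mean in noise standard deviations: the standardised residual
  of coordinate \<open>j\<close> is \<open>signal j + z j\<close>.\<close>

definition signal :: "nat \<Rightarrow> real" where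
  "signal j = lam j * (theta j - eta j) / sqrt eps"

definition obs :: "(nat \<Rightarrow> real) \<Rightarrow> nat \<Rightarrow> real" where
  "obs z j = lam j * theta j + sqrt eps * z j"

definition draw :: "nat \<Rightarrow> (nat \<Rightarrow> real) \<Rightarrow> (nat \<Rightarrow> real) \<Rightarrow> nat \<Rightarrow> real" where
  "draw m Y w j = (if 1 \<le> j \<and> j \<le> m
     then thetaY lam eta tau eps Y j + sqrt (sig lam tau eps j) * w j else eta j)"

definition K :: real where
  "K = 10 * max (1 + 1/d) (sqnorm (\<lambda>j. theta j - eta j) / d\<^sup>2) * L\<^sup>2
        * max (8 * C * (1 + 1/d)) (real D * Lmax lam D)"

lemma Phi0_pos: "0 < Phi0"
  using oracle_upper(2) mult_pos_pos[OF mult_pos_pos[OF eps_pos] Lbar_pos[OF m0(1)]] m0(1)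
  by (metis of_nat_0_less_iff less_le_trans zero_less_one)

lemma D_ge_5: "5 \<le> real D" and D_ge_1: "1 \<le> D" and D_ge_kap: "5 / kap \<le> real D"
proof -
  have "5 / kap \<le> 5 * L / kap" using L_ge_1 kap by (intro divide_right_mono) auto
  then show a: "5 / kap \<le> real D" using D_ge by simp
  have "5 \<le> 5 / kap" using kap by (simp add: field_simps)
  then show b: "5 \<le> real D" using a by simp
  then show "1 \<le> D" by simp
qed

lemma shrink_pos: "1 \<le> j \<Longrightarrow> 0 < shrink j"
  and shrink_le_1: "1 \<le> j \<Longrightarrow> shrink j \<le> 1"
proof -
  assume "1 \<le> j"
  then have "0 < eps * Lam lam j / tau j" using Lam_pos tau_pos eps_pos by simp
  then show "0 < shrink j" "shrink j \<le> 1" by (auto simp: shrink_def)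
qed

text \<open>The two branches of the maximum in \<open>tau_ge\<close> do different work: the linear
  one keeps \<open>shrink\<close> away from 0, the square root one makes the squared shrinkage bias
  comparable to the noise variance.\<close>

lemma eps_Lam_div_tau_le:
  assumes "1 \<le> j" "j \<le> Gdim lam eps"
  shows "eps * Lam lam j / tau j \<le> 1 / d" "eps * Lam lam j / tau j \<le> sqrt (eps * Lam lam j) / d"
proof -
  let ?x = "eps * Lam lam j"
  have x: "0 < ?x" and t: "0 < tau j" using assms Lam_pos tau_pos eps_pos by simp_all
  have m: "d * max (sqrt ?x) ?x \<le> tau j" using tau_ge assms by simp
  have "d * ?x \<le> d * max (sqrt ?x) ?x" "d * sqrt ?x \<le> d * max (sqrt ?x) ?x"
    using d_pos by (auto intro!: mult_left_mono)
  with m have 1: "d * ?x \<le> tau j" and 2: "d * sqrt ?x \<le> tau j" by auto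
  show "?x / tau j \<le> 1 / d" using 1 t d_pos by (simp add: field_simps)
  have "d * ?x = (d * sqrt ?x) * sqrt ?x" using x by simp
  also have "\<dots> \<le> tau j * sqrt ?x" using 2 x by (intro mult_right_mono) auto
  finally show "?x / tau j \<le> sqrt ?x / d" using t d_pos by (simp add: field_simps)
qed

lemma shrink_ge:
  assumes "1 \<le> j" "j \<le> Gdim lam eps"
  shows "1 / (1 + 1/d) \<le> shrink j"
proof -
  have "0 \<le> eps * Lam lam j / tau j" 
    using Lam_pos[OF assms(1)] tau_pos[OF assms(1)] eps_pos by simp
  then show ?thesis
    unfolding shrink_def using eps_Lam_div_tau_le(1)[OF assms] by (intro divide_left_mono) auto
qed

lemma one_minus_shrink_sq_le:
  assumes "1 \<le> j" "j \<le> Gdim lam eps"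
  shows "(1 - shrink j)\<^sup>2 \<le> eps * Lam lam j / d\<^sup>2"
proof -
  let ?y = "eps * Lam lam j / tau j"
  have y: "0 < ?y" and p: "0 < eps * Lam lam j" using Lam_pos[OF assms(1)] tau_pos[OF assms(1)] eps_pos by simp_all
  have "1 - shrink j = ?y / (1 + ?y)" using y by (simp add: shrink_def diff_divide_eq_iff)
  also have "\<dots> \<le> ?y / 1" using y by (intro divide_left_mono) auto
  finally have "1 - shrink j \<le> sqrt (eps * Lam lam j) / d" using eps_Lam_div_tau_le(2)[OF assms] by simp
  then have "(1 - shrink j)\<^sup>2 \<le> (sqrt (eps * Lam lam j) / d)\<^sup>2"
    using shrink_le_1[OF assms(1)] by (intro power_mono) auto
  then show ?thesis using p by (simp add: power_divide)
qed

section \<open>Posterior mean, exponent and draws as functions of white noise\<close>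

lemma sig_eq: "1 \<le> j \<Longrightarrow> sig lam tau eps j = shrink j * (eps * Lam lam j)"
proof -
  assume j: "1 \<le> j"
  have "lam j \<noteq> 0" "tau j > 0" "eps > 0" using j lam_nonzero tau_pos eps_pos by auto
  then show ?thesis
    by (simp add: sig_def shrink_def Lam_def field_simps)
qed

lemma sig_pos: "1 \<le> j \<Longrightarrow> 0 < sig lam tau eps j"
  using sig_eq shrink_pos Lam_pos eps_pos by simp

lemma sig_le: "1 \<le> j \<Longrightarrow> sig lam tau eps j \<le> eps * Lam lam j"
  using shrink_le_1[of j] shrink_pos[of j] Lam_pos[of j] eps_pos by (simp add: sig_eq mult_left_le_one_le)

lemma thetaY_obs_minus_eta:
  assumes "1 \<le> j"
  shows "thetaY lam eta tau eps (obs z) j - eta j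
       = shrink j * (theta j - eta j + sqrt eps * z j / lam j)"
proof -
  have nz: "lam j \<noteq> 0" "tau j > 0" "eps > 0" using assms lam_nonzero tau_pos eps_pos by auto
  \<comment> \<open>Posterior variance times total precision is 1. Multiplying \<open>eta j\<close>
    by this 1 cancels the prior term and leaves the residual of the data.\<close>
  then have "sig lam tau eps j * ((lam j)\<^sup>2 / eps + 1 / tau j) = 1"
    by (simp add: sig_def add_pos_pos add_pos_nonneg less_imp_neq[THEN not_sym])
  then have "thetaY lam eta tau eps (obs z) j - eta j
      = sig lam tau eps j * (eta j / tau j + lam j * obs z j / eps)
        - sig lam tau eps j * ((lam j)\<^sup>2 / eps + 1 / tau j) * eta j"
    by (simp add: thetaY_def)
  also have "\<dots> = sig lam tau eps j * (lam j / eps) * (lam j * (theta j - eta j) + sqrt eps * z j)"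
    by (simp add: obs_def algebra_simps power2_eq_square add_divide_distrib diff_divide_distrib)
  also have "\<dots> = shrink j * (theta j - eta j + sqrt eps * z j / lam j)"
    using nz assms by (simp add: sig_eq Lam_def field_simps power2_eq_square)
  finally show ?thesis .
qed

lemma thetaY_obs_weighted_sq:
  assumes "1 \<le> j"
  shows "(thetaY lam eta tau eps (obs z) j - eta j)\<^sup>2 / sig lam tau eps j
       = shrink j * (signal j + z j)\<^sup>2"
proof -
  have nz: "lam j \<noteq> 0" "eps > 0" "shrink j > 0" using assms lam_nonzero eps_pos shrink_pos by auto
  have "theta j - eta j + sqrt eps * z j / lam j = sqrt eps / lam j * (signal j + z j)"
    using nz by (simp add: signal_def field_simps)
  then have "(thetaY lam eta tau eps (obs z) j - eta j)\<^sup>2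
      = (shrink j)\<^sup>2 * (eps * Lam lam j) * (signal j + z j)\<^sup>2"
    using nz by (simp add: thetaY_obs_minus_eta[OF assms] power_mult_distrib power_divide Lam_def)
  then show ?thesis
    using nz Lam_pos[OF assms] by (simp add: sig_eq[OF assms] power2_eq_square)
qed

lemma post_exponent_obs:
  "post_exponent lam eta tau eps C m (obs z)
     = ((\<Sum>j=1..m. shrink j * (signal j + z j)\<^sup>2) - 3 * C * real m) / 2"
  unfolding post_exponent_def by (simp add: thetaY_obs_weighted_sq)

lemma obs_measurable: "obs \<in> measurable white_noise (PiM UNIV (\<lambda>_. borel))"
  unfolding obs_def[abs_def] by (rule measurable_PiM_single') (auto simp: space_PiM)

lemma data_law_eq: "data_law lam theta eps = distr white_noise (PiM UNIV (\<lambda>_. borel)) obs"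
proof -
  have "data_law lam theta eps
      = PiM UNIV (\<lambda>j. distr std_gauss borel (\<lambda>x. lam j * theta j + sqrt eps * x))"
    unfolding data_law_def using eps_pos by (simp add: normal_eq_distr_std_gauss)
  then show ?thesis
    by (subst (asm) PiM_distr_white_noise) (auto simp: obs_def[abs_def])
qed

lemma sieve_post_eq:
  "sieve_post lam eta tau eps m Y = distr white_noise (PiM UNIV (\<lambda>_. borel)) (draw m Y)"
proof -
  let ?f = "\<lambda>j x. if 1 \<le> j \<and> j \<le> m
     then thetaY lam eta tau eps Y j + sqrt (sig lam tau eps j) * x else eta j"
  have "sieve_post lam eta tau eps m Y = PiM UNIV (\<lambda>j. distr std_gauss borel (?f j))"
    unfolding sieve_post_def
  proof (intro PiM_cong refl)
    fix j
    show "(if 1 \<le> j \<and> j \<le> m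
        then density lborel (normal_density (thetaY lam eta tau eps Y j) (sqrt (sig lam tau eps j)))
        else return borel (eta j)) = distr std_gauss borel (?f j)"
      using normal_eq_distr_std_gauss[of "sqrt (sig lam tau eps j)"] sig_pos[of j]
        return_eq_distr_std_gauss[of "eta j"] by (cases "1 \<le> j \<and> j \<le> m") auto
  qed
  also have "\<dots> = distr white_noise (PiM UNIV (\<lambda>_. borel)) (\<lambda>w j. ?f j (w j))"
    by (rule PiM_distr_white_noise) simp
  finally show ?thesis unfolding draw_def[abs_def] .
qed

lemma sqnorm_draw:
  "sqnorm (\<lambda>j. draw m Y w j - theta j)
     = (\<Sum>j=1..m. (draw m Y w j - theta j)\<^sup>2) + bias theta eta m"
proof -
  have tail: "(draw m Y w (Suc (i + m)) - theta (Suc (i + m)))\<^sup>2 = (theta (i + Suc m) - eta (i + Suc m))\<^sup>2" for i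
    by (simp add: draw_def power2_commute)
  have "summable (\<lambda>i. (draw m Y w (Suc (i + m)) - theta (Suc (i + m)))\<^sup>2)"
    unfolding tail by (rule summable_tail)
  then have s: "summable (\<lambda>i. (draw m Y w (Suc i) - theta (Suc i))\<^sup>2)"
    using summable_iff_shift[of "\<lambda>i. (draw m Y w (Suc i) - theta (Suc i))\<^sup>2" m] by simp
  have "sqnorm (\<lambda>j. draw m Y w j - theta j)
      = (\<Sum>i. (draw m Y w (Suc (i + m)) - theta (Suc (i + m)))\<^sup>2)
        + (\<Sum>i<m. (draw m Y w (Suc i) - theta (Suc i))\<^sup>2)"
    unfolding sqnorm_def by (rule suminf_split_initial_segment[OF s])
  also have "(\<Sum>i<m. (draw m Y w (Suc i) - theta (Suc i))\<^sup>2) = (\<Sum>j=1..m. (draw m Y w j - theta j)\<^sup>2)"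
    by (rule sum.reindex_bij_witness[where i="\<lambda>j. j - 1" and j=Suc]) auto
  finally show ?thesis unfolding tail bias_def by simp
qed

section \<open>Concentration of the posterior dimension\<close>

lemma postM_nonneg: "0 \<le> postM lam eta tau eps C m Y"
  by (simp add: postM_def sum_nonneg)

lemma postM_denominator_ge:
  assumes "1 \<le> m" "m \<le> Gdim lam eps"
  shows "exp (post_exponent lam eta tau eps C m Y)
    \<le> (\<Sum>k=1..Gdim lam eps. exp (post_exponent lam eta tau eps C k Y))"
  using assms by (intro member_le_sum) auto

lemma sum_postM: "(\<Sum>m=1..Gdim lam eps. postM lam eta tau eps C m Y) = 1"
  using less_le_trans[OF exp_gt_zero postM_denominator_ge[OF m0, of Y]]
  by (simp add: postM_def sum_divide_distrib[symmetric])

lemma postM_le_1: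
  assumes "1 \<le> m" "m \<le> Gdim lam eps"
  shows "postM lam eta tau eps C m Y \<le> 1"
  using postM_denominator_ge[OF assms, of Y]
    less_le_trans[OF exp_gt_zero postM_denominator_ge[OF assms, of Y]]
  by (simp add: postM_def divide_le_eq)

text \<open>Only the oracle term of the normalising sum is kept.\<close>

lemma postM_le_exp:
  "postM lam eta tau eps C m Y
    \<le> exp (post_exponent lam eta tau eps C m Y - post_exponent lam eta tau eps C m0 Y)"
  using postM_denominator_ge[OF m0, of Y]
    less_le_trans[OF exp_gt_zero postM_denominator_ge[OF m0, of Y]]
  unfolding postM_def exp_diff by (intro divide_left_mono) auto

lemma postM_le_exp_half:
  assumes "1 \<le> m" "m \<le> Gdim lam eps"
  shows "postM lam eta tau eps C m Y
    \<le> exp ((post_exponent lam eta tau eps C m Y - post_exponent lam eta tau eps C m0 Y) / 2)"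
    (is "_ \<le> exp (?x / 2)")
proof (cases "0 \<le> ?x")
  case True
  then have "1 \<le> exp (?x / 2)" by simp
  then show ?thesis using postM_le_1[OF assms, of Y] by linarith
next
  case False
  then have "exp ?x \<le> exp (?x / 2)" by simp
  then show ?thesis using postM_le_exp[of m Y] by linarith
qed

lemma signal_sq: "1 \<le> j \<Longrightarrow> (signal j)\<^sup>2 = (lam j)\<^sup>2 * (theta j - eta j)\<^sup>2 / eps"
  using eps_pos by (simp add: signal_def power_mult_distrib power_divide)

lemma oracle_variance_pos: "0 < eps * Lmax lam m0"
  using eps_pos Lmax_ge_1[OF m0(1)] by simp

text \<open>Trades the largest noise variance among the first \<open>m0\<close> coordinates for the
  average one, at the price of \<open>L\<close>; in this way the rate controls single
  coordinates.\<close>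

lemma oracle_variance_le: "eps * Lmax lam m0 * real m0 \<le> L * Phi0"
proof -
  have "eps * Lmax lam m0 * real m0 \<le> eps * (L * Lbar lam m0) * real m0"
    using eps_pos Lmax_le_Lbar[OF m0(1)] by (intro mult_right_mono mult_left_mono) auto
  also have "\<dots> = L * (eps * real m0 * Lbar lam m0)" by simp
  also have "\<dots> \<le> L * Phi0" using oracle_upper(2) L_ge_1 by (intro mult_left_mono) auto
  finally show ?thesis .
qed

text \<open>
  Underfitting is bounded in mean directly. For overfitting the exponential of the non-central
  chi-square exponent need not be integrable (the weights \<open>shrink j\<close> may be close to 1), so its
  square root is used, via \<open>min 1 x \<le> sqrt x\<close>.
\<close>

lemma postM_underfit:
  assumes m: "m < m0" and b: "8 * L * C * (1 + 1/d) * Phi0 < bias theta eta m"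
  shows "(\<integral>\<^sup>+z. ennreal (postM lam eta tau eps C m (obs z)) \<partial>white_noise) \<le> ennreal (exp (- real m0 / 5))"
proof -
  let ?J = "{Suc m..m0}" and ?T = "eps * Lmax lam m0"
  \<comment> \<open>Negative weights make the moment finite. \<open>?b\<close> comes from
    \<open>shrink j / (1 + shrink j) \<ge> 1 / (2 + 1/d)\<close>, with the factor
    \<open>1 / sqrt (1 + shrink j)\<close> bounded by 1.\<close>
  let ?c = "\<lambda>j. - shrink j / 2" and ?b = "\<lambda>j. - (signal j)\<^sup>2 / (2 * (2 + 1/d))"
  have jG: "1 \<le> j \<and> j \<le> Gdim lam eps \<and> j \<le> m0" if "j \<in> ?J" for j using that m0 by auto
  have split: "(\<Sum>j=1..m0. f j) = (\<Sum>j=1..m. f j) + (\<Sum>j\<in>?J. f j)" for f :: "nat \<Rightarrow> real"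
    using m sum.ub_add_nat[of 1 m f "m0 - m"] by simp
  have pt: "postM lam eta tau eps C m (obs z)
      \<le> exp (3 * C * real m0 / 2) * exp (\<Sum>j\<in>?J. ?c j * (signal j + z j)\<^sup>2)" for z
  proof -
    have "post_exponent lam eta tau eps C m (obs z) - post_exponent lam eta tau eps C m0 (obs z)
       = (\<Sum>j\<in>?J. ?c j * (signal j + z j)\<^sup>2) + 3 * C * (real m0 - real m) / 2"
      unfolding post_exponent_obs split
      by (simp add: sum_negf sum_divide_distrib[symmetric] field_simps)
    also have "\<dots> \<le> 3 * C * real m0 / 2 + (\<Sum>j\<in>?J. ?c j * (signal j + z j)\<^sup>2)"
      using C_ge_1 by simp
    finally show ?thesis using postM_le_exp[of m "obs z"] by (simp flip: exp_add) (meson exp_le_cancel_iff order_trans)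
  qed
  have "(\<integral>\<^sup>+z. ennreal (postM lam eta tau eps C m (obs z)) \<partial>white_noise)
     \<le> (\<integral>\<^sup>+z. ennreal (exp (3 * C * real m0 / 2)) * ennreal (exp (\<Sum>j\<in>?J. ?c j * (signal j + z j)\<^sup>2)) \<partial>white_noise)"
    using pt by (intro nn_integral_mono) (simp add: ennreal_mult'[symmetric] ennreal_leI)
  also have "\<dots> = ennreal (exp (3 * C * real m0 / 2)) * (\<integral>\<^sup>+z. ennreal (exp (\<Sum>j\<in>?J. ?c j * (signal j + z j)\<^sup>2)) \<partial>white_noise)"
    by (rule nn_integral_cmult) measurable
  also have "\<dots> \<le> ennreal (exp (3 * C * real m0 / 2)) * ennreal (exp (\<Sum>j\<in>?J. ?b j))"
  proof (intro mult_left_mono nn_integral_white_noise_exp_quadratic)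
    fix j assume "j \<in> ?J"
    note j = jG[OF this]
    have s: "0 < shrink j" using j shrink_pos by simp
    show "?c j < 1/2" using s by simp
    have "1 \<le> shrink j * (1 + 1/d)"
      using shrink_ge[of j] j d_pos by (simp add: divide_le_eq add_pos_pos)
    then have "1 + shrink j \<le> shrink j * (2 + 1/d)" by (simp add: algebra_simps)
    moreover have "0 < 2 + 1/d" using d_pos by (simp add: add_pos_pos)
    ultimately have "1 / (2 + 1/d) \<le> shrink j / (1 + shrink j)"
      using s by (simp add: divide_le_eq le_divide_eq mult.commute)
    then have "1 / (2 + 1/d) * ((signal j)\<^sup>2 / 2) \<le> shrink j / (1 + shrink j) * ((signal j)\<^sup>2 / 2)"
      by (intro mult_right_mono) auto
    then have "?c j * (signal j)\<^sup>2 / (1 - 2 * ?c j) \<le> ?b j" by (simp add: mult.commute)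
    then have "exp (?c j * (signal j)\<^sup>2 / (1 - 2 * ?c j)) / sqrt (1 - 2 * ?c j) \<le> exp (?b j) / 1"
      using s by (intro divide_mono) auto
    then show "exp (?c j * (signal j)\<^sup>2 / (1 - 2 * ?c j)) / sqrt (1 - 2 * ?c j) \<le> exp (?b j)" by simp
  qed auto
  also have "\<dots> = ennreal (exp (3 * C * real m0 / 2 + (\<Sum>j\<in>?J. ?b j)))"
    by (simp add: ennreal_mult'[symmetric] exp_add)
  also have "\<dots> \<le> ennreal (exp (- real m0 / 5))"
  proof -
    have T: "0 < ?T" by (rule oracle_variance_pos)
    \<comment> \<open>The bias lost between \<open>m\<close> and \<open>m0\<close> becomes signal
      energy: \<open>Lam lam j \<le> Lmax lam m0\<close> there, so the energy is at least the lost
      bias divided by \<open>?T\<close>.\<close>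
    have "(8 * L * C * (1 + 1/d) - 1) * Phi0 \<le> bias theta eta m - bias theta eta m0"
      using b oracle_upper(1) by (simp add: algebra_simps)
    also have "\<dots> = (\<Sum>j\<in>?J. (theta j - eta j)\<^sup>2)" using bias_split[of m m0] m by simp
    also have "\<dots> \<le> (\<Sum>j\<in>?J. ?T * (signal j)\<^sup>2)"
    proof (rule sum_mono)
      fix j assume "j \<in> ?J"
      note j = jG[OF this]
      have "1 \<le> Lmax lam m0 * (lam j)\<^sup>2"
        using Lam_le_Lmax[of j m0] j lam_nonzero[of j] by (simp add: Lam_def divide_le_eq)
      then have "1 * (theta j - eta j)\<^sup>2 \<le> Lmax lam m0 * (lam j)\<^sup>2 * (theta j - eta j)\<^sup>2"
        by (intro mult_right_mono) auto
      then show "(theta j - eta j)\<^sup>2 \<le> ?T * (signal j)\<^sup>2"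
        using signal_sq[of j] j eps_pos by simp
    qed
    finally have 1: "(8 * L * C * (1 + 1/d) - 1) * Phi0 \<le> ?T * (\<Sum>j\<in>?J. (signal j)\<^sup>2)"
      by (simp add: sum_distrib_left)
    have CL: "1 \<le> L * (C * (1 + 1/d))" and Cd: "C \<le> C * (1 + 1/d)"
    proof -
      show Cd: "C \<le> C * (1 + 1/d)" using C_ge_1 d_pos by (simp add: distrib_left)
      have "1 * 1 \<le> L * (C * (1 + 1/d))" using L_ge_1 C_ge_1 order_trans[OF C_ge_1 Cd] by (intro mult_mono) auto
      then show "1 \<le> L * (C * (1 + 1/d))" by simp
    qed
    \<comment> \<open>Since \<open>L * C * (1 + 1/d) \<ge> 1\<close>, taking 1 away from 8 times it
      leaves at least 7 times it.\<close>
    have "7 * C * (1 + 1/d) * (?T * real m0) \<le> 7 * C * (1 + 1/d) * (L * Phi0)"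
      using oracle_variance_le C_ge_1 d_pos by (intro mult_left_mono) auto
    also have "\<dots> = (7 * (L * (C * (1 + 1/d)))) * Phi0" by simp
    also have "\<dots> \<le> (8 * L * C * (1 + 1/d) - 1) * Phi0"
    proof (rule mult_right_mono)
      define X where "X = L * (C * (1 + 1/d))"
      have X: "8 * L * C * (1 + 1/d) = 8 * X" by (simp add: X_def mult.assoc)
      show "7 * (L * (C * (1 + 1/d))) \<le> 8 * L * C * (1 + 1/d) - 1"
        using CL unfolding X unfolding X_def[symmetric] by simp
    qed (use Phi0_pos in simp)
    finally have "?T * (7 * C * (1 + 1/d) * real m0) \<le> ?T * (\<Sum>j\<in>?J. (signal j)\<^sup>2)"
      using 1 by (simp add: mult_ac)
    then have 2: "7 * C * (1 + 1/d) * real m0 \<le> (\<Sum>j\<in>?J. (signal j)\<^sup>2)"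
      using T by (rule mult_left_le_imp_le)
    have p: "0 < 2 * (2 + 1/d)" using d_pos by (simp add: add_pos_pos)
    \<comment> \<open>Weakening \<open>1 + 1/d\<close> to \<open>1 + 1/d/2\<close> cancels the
      denominator. The gain 7/4 then exceeds the penalty 3/2 by 1/4, which yields the exponent
      \<open>- m0 / 5\<close>.\<close>
    have "7/4 * C * real m0 = 7 * C * (1 + 1/d/2) * real m0 / (2 * (2 + 1/d))"
    proof -
      have e: "2 * (2 + 1/d) = 4 * (1 + 1/d/2)" by simp
      have "1 + 1/d/2 \<noteq> 0" using p unfolding e by auto
      moreover have "7/4 * C * real m0 = 7 * C * y * real m0 / (4 * y)" if "y \<noteq> 0" for y
        using that by simp
      ultimately show ?thesis unfolding e by blast
    qed
    also have "\<dots> \<le> (\<Sum>j\<in>?J. (signal j)\<^sup>2) / (2 * (2 + 1/d))"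
    proof (intro divide_right_mono order_trans[OF _ 2])
      show "7 * C * (1 + 1/d/2) * real m0 \<le> 7 * C * (1 + 1/d) * real m0"
        using C_ge_1 d_pos by (intro mult_right_mono mult_left_mono) (auto simp: field_simps)
    qed (use p in auto)
    finally have "(\<Sum>j\<in>?J. ?b j) \<le> - (7/4 * C * real m0)"
      by (simp add: sum_negf sum_divide_distrib)
    then have "3 * C * real m0 / 2 + (\<Sum>j\<in>?J. ?b j) \<le> - (C * real m0) / 4" by simp
    also have "\<dots> \<le> - real m0 / 5" using mult_right_mono[OF C_ge_1, of "real m0"] by simp
    finally show ?thesis by (intro ennreal_leI) simp
  qed
  finally show ?thesis .
qed

lemma postM_overfit:
  assumes m: "D * m0 < m" "m \<le> Gdim lam eps"
  shows "(\<integral>\<^sup>+z. ennreal (postM lam eta tau eps C m (obs z)) \<partial>white_noise) \<le> ennreal (exp (- real m0 / 5))"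
proof -
  let ?J = "{Suc m0..m}" and ?T = "eps * Lmax lam m0"
  \<comment> \<open>As \<open>shrink j \<le> 1\<close>, the halved exponent has
    \<open>1 - 2 * ?c j \<ge> 1/2\<close>: the root costs \<open>sqrt 2 \<le> exp (7/20)\<close>,
    and the coefficient of the squared signal is at most 1/2.\<close>
  let ?c = "\<lambda>j. shrink j / 4" and ?b = "\<lambda>j. 7/20 + (signal j)\<^sup>2 / 2"
  have "real D * real m0 < real m" using m(1) by (metis of_nat_less_iff of_nat_mult)
  moreover have "5 * real m0 \<le> real D * real m0" using D_ge_5 by (intro mult_right_mono) auto
  ultimately have m5: "5 * real m0 \<le> real m" and mD: "real D * real m0 \<le> real m" by auto
  then have mm: "m0 \<le> m" "1 \<le> m" using m0 by auto
  have jG: "1 \<le> j \<and> j \<le> Gdim lam eps \<and> m0 < j" if "j \<in> ?J" for j using that m0 m by auto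
  have split: "(\<Sum>j=1..m. f j) = (\<Sum>j=1..m0. f j) + (\<Sum>j\<in>?J. f j)" for f :: "nat \<Rightarrow> real"
    using mm sum.ub_add_nat[of 1 m0 f "m - m0"] by simp
  have pt: "postM lam eta tau eps C m (obs z)
      \<le> exp (- 3 * C * (real m - real m0) / 4) * exp (\<Sum>j\<in>?J. ?c j * (signal j + z j)\<^sup>2)" for z
  proof -
    have "(post_exponent lam eta tau eps C m (obs z) - post_exponent lam eta tau eps C m0 (obs z)) / 2
       = - 3 * C * (real m - real m0) / 4 + (\<Sum>j\<in>?J. ?c j * (signal j + z j)\<^sup>2)"
      unfolding post_exponent_obs split
      by (simp add: sum_divide_distrib[symmetric] field_simps)
    then show ?thesis using postM_le_exp_half[OF mm(2) m(2), of "obs z"]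
      unfolding exp_add[symmetric] by (simp only:)
  qed
  have "(\<integral>\<^sup>+z. ennreal (postM lam eta tau eps C m (obs z)) \<partial>white_noise)
     \<le> (\<integral>\<^sup>+z. ennreal (exp (- 3 * C * (real m - real m0) / 4)) * ennreal (exp (\<Sum>j\<in>?J. ?c j * (signal j + z j)\<^sup>2)) \<partial>white_noise)"
    using pt by (intro nn_integral_mono) (simp add: ennreal_mult'[symmetric] ennreal_leI)
  also have "\<dots> = ennreal (exp (- 3 * C * (real m - real m0) / 4)) * (\<integral>\<^sup>+z. ennreal (exp (\<Sum>j\<in>?J. ?c j * (signal j + z j)\<^sup>2)) \<partial>white_noise)"
    by (rule nn_integral_cmult) measurable
  also have "\<dots> \<le> ennreal (exp (- 3 * C * (real m - real m0) / 4)) * ennreal (exp (\<Sum>j\<in>?J. ?b j))"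
  proof (intro mult_left_mono nn_integral_white_noise_exp_quadratic)
    fix j assume "j \<in> ?J"
    note j = jG[OF this]
    have s: "0 < shrink j" "shrink j \<le> 1" using j shrink_pos shrink_le_1 by auto
    show "?c j < 1/2" using s by simp
    have "?c j / (1 - 2 * ?c j) \<le> 1/2" using s by (simp add: field_simps)
    then have "?c j / (1 - 2 * ?c j) * (signal j)\<^sup>2 \<le> 1/2 * (signal j)\<^sup>2"
      by (intro mult_right_mono) auto
    then have e: "exp (?c j * (signal j)\<^sup>2 / (1 - 2 * ?c j)) \<le> exp ((signal j)\<^sup>2 / 2)" by simp
    have "sqrt (1/2) \<le> sqrt (1 - 2 * ?c j)" using s by simp
    then have "exp (?c j * (signal j)\<^sup>2 / (1 - 2 * ?c j)) / sqrt (1 - 2 * ?c j) \<le> exp ((signal j)\<^sup>2 / 2) / sqrt (1/2)"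
      using e by (intro divide_mono) auto
    also have "\<dots> = sqrt 2 * exp ((signal j)\<^sup>2 / 2)" by (simp add: real_sqrt_divide)
    also have "\<dots> \<le> exp (7/20) * exp ((signal j)\<^sup>2 / 2)"
      using sqrt_2_le_exp by (intro mult_right_mono) auto
    finally show "exp (?c j * (signal j)\<^sup>2 / (1 - 2 * ?c j)) / sqrt (1 - 2 * ?c j) \<le> exp (?b j)"
      by (simp add: exp_add)
  qed auto
  also have "\<dots> = ennreal (exp (- 3 * C * (real m - real m0) / 4 + (\<Sum>j\<in>?J. ?b j)))"
    by (simp add: ennreal_mult'[symmetric] exp_add[symmetric])
  also have "\<dots> \<le> ennreal (exp (- real m0 / 5))"
  proof -
    have T: "0 < ?T" by (rule oracle_variance_pos)
    \<comment> \<open>Beyond \<open>m0\<close> the factor \<open>Lmax lam m0 * (lam j)^2\<close> is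
      at most \<open>C\<close>, so the signal energy is bounded by the remaining bias.\<close>
    have "?T * (\<Sum>j\<in>?J. (signal j)\<^sup>2) \<le> (\<Sum>j\<in>?J. C * (theta j - eta j)\<^sup>2)"
      unfolding sum_distrib_left
    proof (rule sum_mono)
      fix j assume "j \<in> ?J"
      note j = jG[OF this]
      have "Lmax lam m0 * (lam j)\<^sup>2 \<le> C"
        using lam_sq_le[OF m0(1), of j] j Lmax_ge_1[OF m0(1)] by (simp add: le_divide_eq mult.commute)
      then have "Lmax lam m0 * (lam j)\<^sup>2 * (theta j - eta j)\<^sup>2 \<le> C * (theta j - eta j)\<^sup>2"
        by (intro mult_right_mono) auto
      then show "?T * (signal j)\<^sup>2 \<le> C * (theta j - eta j)\<^sup>2"
        using signal_sq[of j] j eps_pos by simp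
    qed
    also have "\<dots> = C * (bias theta eta m0 - bias theta eta m)"
      using bias_split[OF mm(1)] by (simp add: sum_distrib_left)
    also have "\<dots> \<le> C * Phi0"
      using bias_nonneg[of m] oracle_upper(1) C_ge_1 by (intro mult_left_mono) auto
    \<comment> \<open>The lower oracle bound gives \<open>Phi0 \<le> ?T * (m0 / kap)\<close>, and
      \<open>m \<ge> D * m0 \<ge> 5 / kap * m0\<close>: the 5 in the choice of \<open>D\<close>
      becomes the 1/5 here.\<close>
    also have "\<dots> \<le> ?T * (C * (real m / 5))"
    proof -
      have "kap * Phi0 \<le> eps * real m0 * Lmax lam m0"
        using eps_pos by (intro order_trans[OF oracle_lower(2)] mult_left_mono Lbar_le_Lmax m0) auto
      then have "Phi0 \<le> ?T * (real m0 / kap)" using kap by (simp add: field_simps)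
      also have "\<dots> \<le> ?T * (real m / 5)"
      proof -
        have "5 / kap * real m0 \<le> real D * real m0" using D_ge_kap by (intro mult_right_mono) auto
        then have "5 * (real m0 / kap) \<le> real m" using mD by simp
        then have "real m0 / kap \<le> real m / 5" by linarith
        then show ?thesis using T by (intro mult_left_mono) auto
      qed
      finally have "C * Phi0 \<le> C * (?T * (real m / 5))" using C_ge_1 by (intro mult_left_mono) auto
      then show ?thesis by (simp add: mult_ac)
    qed
    finally have S: "(\<Sum>j\<in>?J. (signal j)\<^sup>2) \<le> C * (real m / 5)"
      using T by (rule mult_left_le_imp_le)
    have b: "(\<Sum>j\<in>?J. ?b j) = 7/20 * (real m - real m0) + (\<Sum>j\<in>?J. (signal j)\<^sup>2) / 2"
      using mm by (simp add: sum.distrib sum_divide_distrib of_nat_diff)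
    have "- 3 * C * (real m - real m0) / 4 + (\<Sum>j\<in>?J. ?b j)
        \<le> (7/20 - 3 * C / 4) * (real m - real m0) + C * real m / 10"
    proof -
      have "(7/20 - 3 * C / 4) * r = 7/20 * r + - 3 * C * r / 4" for r by (simp add: algebra_simps)
      moreover have "C * real m / 10 = C * (real m / 5) / 2" by simp
      ultimately show ?thesis using S b by simp
    qed
    \<comment> \<open>The coefficient is negative, so \<open>m - m0\<close> is replaced by its lower
      bound \<open>4/5 * m\<close>. With \<open>C \<ge> 1\<close> the total is at most
      \<open>- 11/50 * m\<close>, and \<open>m \<ge> 5 * m0\<close>.\<close>
    also have "(7/20 - 3 * C / 4) * (real m - real m0) \<le> (7/20 - 3 * C / 4) * (4/5 * real m)"
      using m5 C_ge_1 by (intro mult_left_mono_neg) auto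
    also have "(7/20 - 3 * C / 4) * (4/5 * real m) + C * real m / 10 = 7/25 * real m - C * real m / 2"
      by (simp add: algebra_simps)
    also have "\<dots> \<le> - real m0 / 5"
      using mult_right_mono[OF C_ge_1, of "real m"] m5 by simp
    finally show ?thesis by (intro ennreal_leI) simp
  qed
  finally show ?thesis .
qed

section \<open>Posterior loss for a fixed dimension\<close>

lemma K_factors:
  "1 \<le> max (1 + 1/d) (sqnorm (\<lambda>j. theta j - eta j) / d\<^sup>2)"
  "1 \<le> L\<^sup>2" "L \<le> L\<^sup>2"
  "0 < max (8 * C * (1 + 1/d)) (real D * Lmax lam D)"
  using d_pos L_ge_1 C_ge_1 D_ge_1 Lmax_ge_1[OF D_ge_1]
  by (auto simp: max.coboundedI1 power2_eq_square less_max_iff_disj mult_ge1_I)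

text \<open>Submultiplicativity lets the window grow from \<open>m0\<close> to \<open>D * m0\<close>
  for a factor \<open>D * Lmax lam D\<close> independent of the noise level; this explains that
  entry of the maximum in \<open>K\<close>.\<close>

lemma oracle_variance_window_le:
  "eps * Lmax lam (D * m0) * real (D * m0)
     \<le> max (8 * C * (1 + 1/d)) (real D * Lmax lam D) * (L\<^sup>2 * Phi0)"
proof -
  have "eps * Lmax lam (D * m0) * real (D * m0) \<le> eps * (Lmax lam D * Lmax lam m0) * real (D * m0)"
    using eps_pos Lmax_mult_le[OF D_ge_1 m0(1)] by (intro mult_right_mono mult_left_mono) auto
  also have "\<dots> = real D * Lmax lam D * (eps * Lmax lam m0 * real m0)" by simp
  also have "\<dots> \<le> max (8 * C * (1 + 1/d)) (real D * Lmax lam D) * (L\<^sup>2 * Phi0)"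
  proof (rule mult_mono)
    have "L * Phi0 \<le> L\<^sup>2 * Phi0" using K_factors(3) Phi0_pos by (intro mult_right_mono) auto
    then show "eps * Lmax lam m0 * real m0 \<le> L\<^sup>2 * Phi0" using oracle_variance_le by simp
  qed (use K_factors(4) oracle_variance_pos in auto)
  finally show ?thesis .
qed

text \<open>The error splits into shrinkage bias, data noise and posterior noise; each squared part
  carries the factor \<open>eps * Lam lam j\<close>.\<close>

lemma draw_obs_error_sq_le:
  assumes j: "1 \<le> j" "j \<le> m" "m \<le> Gdim lam eps"
  shows "(draw m (obs z) w j - theta j)\<^sup>2
    \<le> eps * Lam lam j * (5 * ((theta j - eta j)\<^sup>2 / d\<^sup>2) + 5/2 * ((z j)\<^sup>2 + (w j)\<^sup>2))"
proof -
  let ?x = "eps * Lam lam j"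
  let ?p = "- (1 - shrink j) * (theta j - eta j)" and ?q = "shrink j * (sqrt eps * z j / lam j)"
    and ?r = "sqrt (sig lam tau eps j) * w j"
  have x: "0 < ?x" using Lam_pos[OF j(1)] eps_pos by simp
  have s: "0 < shrink j" "shrink j \<le> 1" using shrink_pos shrink_le_1 j by auto
  have "draw m (obs z) w j - theta j = ?p + ?q + ?r"
    using thetaY_obs_minus_eta[OF j(1), of z] j by (simp add: draw_def algebra_simps)
  then have "(draw m (obs z) w j - theta j)\<^sup>2 = (?p + ?q + ?r)\<^sup>2" by (simp only:)
  also have "\<dots> \<le> 5 * ?p\<^sup>2 + 5/2 * (?q\<^sup>2 + ?r\<^sup>2)"
    by (rule sq_sum3_le)
  also have "\<dots> \<le> 5 * (?x / d\<^sup>2 * (theta j - eta j)\<^sup>2) + 5/2 * (?x * (z j)\<^sup>2 + ?x * (w j)\<^sup>2)"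
  proof -
    have "?p\<^sup>2 = (1 - shrink j)\<^sup>2 * (theta j - eta j)\<^sup>2" by (simp add: power_mult_distrib power2_commute)
    also have "\<dots> \<le> ?x / d\<^sup>2 * (theta j - eta j)\<^sup>2"
      using one_minus_shrink_sq_le[of j] j by (intro mult_right_mono) auto
    finally have p: "?p\<^sup>2 \<le> ?x / d\<^sup>2 * (theta j - eta j)\<^sup>2" .
    have "?q\<^sup>2 = (shrink j)\<^sup>2 * (?x * (z j)\<^sup>2)"
      using eps_pos by (simp add: power_mult_distrib power_divide Lam_def)
    also have "\<dots> \<le> 1 * (?x * (z j)\<^sup>2)"
      using s x by (intro mult_right_mono) (auto simp: power_le_one)
    finally have q: "?q\<^sup>2 \<le> ?x * (z j)\<^sup>2" by simp
    have "?r\<^sup>2 = sig lam tau eps j * (w j)\<^sup>2"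
      using sig_pos[OF j(1)] by (simp add: power_mult_distrib)
    also have "\<dots> \<le> ?x * (w j)\<^sup>2" using sig_le[OF j(1)] by (intro mult_right_mono) auto
    finally have r: "?r\<^sup>2 \<le> ?x * (w j)\<^sup>2" .
    show ?thesis by (intro add_mono mult_left_mono p q r) auto
  qed
  also have "\<dots> = ?x * (5 * ((theta j - eta j)\<^sup>2 / d\<^sup>2) + 5/2 * ((z j)\<^sup>2 + (w j)\<^sup>2))"
    by (simp add: algebra_simps)
  finally show ?thesis .
qed

lemma sqnorm_draw_le:
  assumes m: "m \<le> D * m0" "m \<le> Gdim lam eps"
    and b: "bias theta eta m \<le> 8 * L * C * (1 + 1/d) * Phi0"
    and z: "(\<Sum>j=1..D * m0. (z j)\<^sup>2) < 3/2 * real (D * m0)"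
    and w: "(\<Sum>j=1..D * m0. (w j)\<^sup>2) < 3/2 * real (D * m0)"
  shows "sqnorm (\<lambda>j. draw m (obs z) w j - theta j) \<le> K * Phi0"
proof -
  let ?n = "D * m0" and ?T = "eps * Lmax lam (D * m0)"
  let ?M = "max (1 + 1/d) (sqnorm (\<lambda>j. theta j - eta j) / d\<^sup>2)"
    and ?B = "max (8 * C * (1 + 1/d)) (real D * Lmax lam D)"
  let ?f = "\<lambda>j. 5 * ((theta j - eta j)\<^sup>2 / d\<^sup>2) + 5/2 * ((z j)\<^sup>2 + (w j)\<^sup>2)"
  have n1: "1 \<le> ?n" using D_ge_1 m0(1) by simp
  have T: "0 < ?T" using Lmax_ge_1[OF n1] eps_pos by simp
  have "real D * 1 \<le> real D * real m0" using m0(1) by (intro mult_left_mono) auto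
  then have n5: "5 \<le> real ?n" using D_ge_5 unfolding of_nat_mult by linarith
  have M: "1 \<le> ?M" and B: "0 < ?B" using K_factors by auto
  have "(\<Sum>j=1..m. (draw m (obs z) w j - theta j)\<^sup>2) \<le> (\<Sum>j=1..m. ?T * ?f j)"
  proof (rule sum_mono)
    fix j assume j: "j \<in> {1..m}"
    have "(draw m (obs z) w j - theta j)\<^sup>2 \<le> eps * Lam lam j * ?f j"
      using j m by (intro draw_obs_error_sq_le) auto
    also have "\<dots> \<le> ?T * ?f j"
      using Lam_le_Lmax[of j ?n] j m eps_pos by (intro mult_right_mono mult_left_mono) auto
    finally show "(draw m (obs z) w j - theta j)\<^sup>2 \<le> ?T * ?f j" .
  qed
  \<comment> \<open>Extending the non-negative sum to the whole window lets the same two chi-square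
    events serve every admissible \<open>m\<close>.\<close>
  also have "\<dots> \<le> (\<Sum>j=1..?n. ?T * ?f j)"
    using m T by (intro sum_mono2) auto
  also have "\<dots> = ?T * (5 * ((\<Sum>j=1..?n. (theta j - eta j)\<^sup>2) / d\<^sup>2)
      + 5/2 * ((\<Sum>j=1..?n. (z j)\<^sup>2) + (\<Sum>j=1..?n. (w j)\<^sup>2)))"
    by (simp only: sum_distrib_left[symmetric] sum.distrib sum_divide_distrib[symmetric])
  also have "\<dots> \<le> ?T * (real ?n * ?M + 15/2 * real ?n * ?M)"
  proof (intro mult_left_mono add_mono)
    \<comment> \<open>The bias part \<open>5 * ?M\<close> is absorbed by \<open>?n \<ge> 5\<close>.
      The two noise sums give 5/2 * (3/2 + 3/2) = 15/2, so the total is 17/2.\<close>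
    have "(\<Sum>j=1..?n. (theta j - eta j)\<^sup>2) / d\<^sup>2 \<le> ?M"
      using partial_sum_le_sqnorm[of ?n] by (intro max.coboundedI2 divide_right_mono) auto
    then have "5 * ((\<Sum>j=1..?n. (theta j - eta j)\<^sup>2) / d\<^sup>2) \<le> real ?n * ?M"
      using n5 M by (intro mult_mono) (auto intro!: divide_nonneg_nonneg sum_nonneg)
    then show "5 * ((\<Sum>j=1..?n. (theta j - eta j)\<^sup>2) / d\<^sup>2) \<le> real ?n * ?M" .
    have "5/2 * ((\<Sum>j=1..?n. (z j)\<^sup>2) + (\<Sum>j=1..?n. (w j)\<^sup>2)) \<le> 15/2 * real ?n * 1"
      using z w by simp
    also have "\<dots> \<le> 15/2 * real ?n * ?M" using M by (intro mult_left_mono) auto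
    finally show "5/2 * ((\<Sum>j=1..?n. (z j)\<^sup>2) + (\<Sum>j=1..?n. (w j)\<^sup>2)) \<le> 15/2 * real ?n * ?M" .
  qed (use T in auto)
  also have "\<dots> = 17/2 * ?M * (?T * real ?n)" by (simp add: algebra_simps)
  also have "\<dots> \<le> 17/2 * ?M * (?B * (L\<^sup>2 * Phi0))"
    using oracle_variance_window_le M by (intro mult_left_mono) auto
  finally have S: "(\<Sum>j=1..m. (draw m (obs z) w j - theta j)\<^sup>2) \<le> 17/2 * (?M * (?B * (L\<^sup>2 * Phi0)))"
    by simp
  have "bias theta eta m \<le> 8 * C * (1 + 1/d) * (L * Phi0)" using b by (simp add: mult_ac)
  also have "\<dots> \<le> ?B * (L\<^sup>2 * Phi0)"
    using K_factors(3) Phi0_pos L_ge_1 C_ge_1 d_pos B by (intro mult_mono) auto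
  also have "\<dots> \<le> ?M * (?B * (L\<^sup>2 * Phi0))"
    using mult_right_mono[OF M, of "?B * (L\<^sup>2 * Phi0)"] B Phi0_pos by simp
  finally have b': "bias theta eta m \<le> ?M * (?B * (L\<^sup>2 * Phi0))" .
  define Q where "Q = ?M * (?B * (L\<^sup>2 * Phi0))"
  \<comment> \<open>The coordinates up to \<open>m\<close> contribute \<open>17/2 * Q\<close> and
    the truncation bias at most \<open>Q\<close>, which fits under the leading 10 of
    \<open>K\<close>.\<close>
  have K: "K * Phi0 = 10 * Q" unfolding K_def Q_def by (simp only: mult_ac)
  show ?thesis
    unfolding sqnorm_draw K using S b' bias_nonneg[of m] unfolding Q_def[symmetric] by linarith
qed

text \<open>The maxima in \<open>K\<close> dominate \<open>1 + 1/d\<close> and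
  \<open>D \<ge> 5 / kap\<close>. The first claim puts the lower threshold below a tenth of the
  posterior variance, for \<open>m \<ge> m0\<close>; the last puts it below the truncation bias, for
  \<open>m < m0\<close>.\<close>

lemma Phi0_div_K_le: "Phi0 / K \<le> kap * Phi0 / (10 * (1 + 1/d))" "0 < K" "1 \<le> K * kap"
proof -
  let ?M = "max (1 + 1/d) (sqnorm (\<lambda>j. theta j - eta j) / d\<^sup>2)"
    and ?B = "max (8 * C * (1 + 1/d)) (real D * Lmax lam D)"
  have d1: "1 < 1 + 1/d" using d_pos by simp
  have "real D * 1 \<le> real D * Lmax lam D" using Lmax_ge_1[OF D_ge_1] by (intro mult_left_mono) auto
  then have B: "5 / kap \<le> ?B" using D_ge_kap by simp
  have "10 * (1 + 1/d) * 1 * (5 / kap) \<le> 10 * ?M * L\<^sup>2 * ?B"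
    using B d1 K_factors kap by (intro mult_mono) auto
  then have K: "10 * (1 + 1/d) * (5 / kap) \<le> K" unfolding K_def by simp
  have p: "0 < 10 * (1 + 1/d) / kap" using less_trans[OF zero_less_one d1] kap(1) by (intro divide_pos_pos mult_pos_pos) simp_all
  have K': "10 * (1 + 1/d) / kap \<le> K"
  proof -
    define y where "y = 10 * (1 + 1/d) / kap"
    have e: "10 * (1 + 1/d) * (5 / kap) = 5 * y" by (simp add: y_def)
    have "5 * y \<le> K" using K unfolding e .
    then show ?thesis using p unfolding y_def[symmetric] by linarith
  qed
  then show Kp: "0 < K" using p by linarith
  have "Phi0 / K \<le> Phi0 / (10 * (1 + 1/d) / kap)"
    by (rule divide_left_mono[OF K' less_imp_le[OF Phi0_pos] mult_pos_pos[OF Kp p]])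
  then show "Phi0 / K \<le> kap * Phi0 / (10 * (1 + 1/d))" by (simp add: mult.commute)
  have "10 * (1 + 1/d) \<le> K * kap" using K' kap by (simp add: divide_le_eq)
  moreover have "1 \<le> y" if "10 * x \<le> y" "1 < x" for x y :: real using that by linarith
  ultimately show "1 \<le> K * kap" using d1 by blast
qed

text \<open>
  For \<open>m < m0\<close> the truncation bias alone exceeds the threshold; for \<open>m \<ge> m0\<close> the posterior
  variance of the first \<open>m0\<close> coordinates suffices, whatever the data.
\<close>

lemma draw_small_ball:
  assumes m: "1 \<le> m" "m \<le> Gdim lam eps"
  shows "measure white_noise {w. sqnorm (\<lambda>j. draw m Y w j - theta j) < Phi0 / K}
    \<le> exp (- real m0 / (5 * (1 + 1/d) * L))"
proof (cases "m < m0")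
  case True
  have "Phi0 \<le> K * kap * Phi0" using Phi0_div_K_le(3) Phi0_pos by simp
  then have "Phi0 / K \<le> kap * Phi0" using Phi0_div_K_le(2) by (simp add: divide_le_eq mult_ac)
  also have "\<dots> \<le> bias theta eta m0" by (rule oracle_lower)
  also have "\<dots> \<le> bias theta eta m" using True by (intro bias_antimono) auto
  finally have "\<not> sqnorm (\<lambda>j. draw m Y w j - theta j) < Phi0 / K" for w
    unfolding sqnorm_draw by (simp add: not_less sum_nonneg add_increasing)
  then show ?thesis by simp
next
  case False
  interpret W: prob_space white_noise by (rule prob_space_white_noise)
  let ?s = "\<lambda>j. sig lam tau eps j" and ?v = "\<lambda>j. thetaY lam eta tau eps Y j - theta j"
  have d1: "0 < 1 + 1/d" using d_pos by (simp add: add_pos_pos)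
  \<comment> \<open>Posterior variances lose at most the factor \<open>1 + 1/d\<close> against noise
    variances, so their sum keeps the order of the oracle rate.\<close>
  have "(\<Sum>j=1..m0. eps * Lam lam j / (1 + 1/d)) \<le> (\<Sum>j=1..m0. ?s j)"
  proof (rule sum_mono)
    fix j assume "j \<in> {1..m0}"
    then have j: "1 \<le> j" "j \<le> Gdim lam eps" using m0 by auto
    have "1 / (1 + 1/d) * (eps * Lam lam j) \<le> shrink j * (eps * Lam lam j)"
      using shrink_ge[OF j] Lam_pos[OF j(1)] eps_pos by (intro mult_right_mono) auto
    then show "eps * Lam lam j / (1 + 1/d) \<le> ?s j" using sig_eq[OF j(1)] by simp
  qed
  then have "eps * (\<Sum>j=1..m0. Lam lam j) / (1 + 1/d) \<le> (\<Sum>j=1..m0. ?s j)"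
    by (simp add: sum_distrib_left sum_divide_distrib)
  then have S: "eps * real m0 * Lbar lam m0 / (1 + 1/d) \<le> (\<Sum>j=1..m0. ?s j)"
    unfolding real_times_Lbar[symmetric] by (simp add: mult_ac)
  have *: "kap * Phi0 / (1 + 1/d) \<le> (\<Sum>j=1..m0. ?s j)"
    using S divide_right_mono[OF oracle_lower(2), of "1 + 1/d"] d1 by linarith
  have thr: "Phi0 / K \<le> (\<Sum>j=1..m0. ?s j) / 10"
  proof -
    note Phi0_div_K_le(1)
    also have "kap * Phi0 / (10 * (1 + 1/d)) = kap * Phi0 / (1 + 1/d) / 10"
      by (simp only: divide_divide_eq_left mult.commute)
    also have "\<dots> \<le> (\<Sum>j=1..m0. ?s j) / 10" using * by (rule divide_right_mono) simp
    finally show ?thesis .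
  qed
  have "{w. sqnorm (\<lambda>j. draw m Y w j - theta j) < Phi0 / K}
     \<subseteq> {w. (\<Sum>j=1..m0. (?v j + sqrt (?s j) * w j)\<^sup>2) \<le> (\<Sum>j=1..m0. ?s j) / 10}"
  proof clarify
    fix w assume a: "sqnorm (\<lambda>j. draw m Y w j - theta j) < Phi0 / K"
    have "(\<Sum>j=1..m0. (?v j + sqrt (?s j) * w j)\<^sup>2) = (\<Sum>j=1..m0. (draw m Y w j - theta j)\<^sup>2)"
      using False by (intro sum.cong) (auto simp: draw_def algebra_simps)
    also have "\<dots> \<le> (\<Sum>j=1..m. (draw m Y w j - theta j)\<^sup>2)"
      using False by (intro sum_mono2) auto
    also have "\<dots> \<le> sqnorm (\<lambda>j. draw m Y w j - theta j)"
      unfolding sqnorm_draw using bias_nonneg by simp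
    finally show "(\<Sum>j=1..m0. (?v j + sqrt (?s j) * w j)\<^sup>2) \<le> (\<Sum>j=1..m0. ?s j) / 10"
      using a thr by linarith
  qed
  moreover have "{w \<in> space white_noise. (\<Sum>j=1..m0. (?v j + sqrt (?s j) * w j)\<^sup>2) \<le> (\<Sum>j=1..m0. ?s j) / 10} \<in> sets white_noise"
    by measurable
  ultimately have "measure white_noise {w. sqnorm (\<lambda>j. draw m Y w j - theta j) < Phi0 / K}
     \<le> measure white_noise {w. (\<Sum>j=1..m0. (?v j + sqrt (?s j) * w j)\<^sup>2) \<le> (\<Sum>j=1..m0. ?s j) / 10}"
    by (intro W.finite_measure_mono) auto
  also have "\<dots> \<le> exp (- (\<Sum>j=1..m0. ?s j) / (5 * (eps * Lmax lam m0)))"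
  proof (rule gaussian_small_ball)
    fix j assume "j \<in> {1..m0}"
    then have j: "1 \<le> j" "j \<le> m0" by auto
    show "0 < ?s j" by (rule sig_pos[OF j(1)])
    have "eps * Lam lam j \<le> eps * Lmax lam m0" using Lam_le_Lmax[OF j] eps_pos by simp
    then show "?s j \<le> eps * Lmax lam m0" using sig_le[OF j(1)] by linarith
  qed (use oracle_variance_pos in auto)
  also have "\<dots> \<le> exp (- real m0 / (5 * (1 + 1/d) * L))"
  proof -
    \<comment> \<open>Total variance over the bound \<open>eps * Lmax lam m0\<close> acts as an
      effective number of degrees of freedom; comparing \<open>Lmax\<close> with \<open>Lbar\<close>
      makes it proportional to \<open>m0\<close>.\<close>
    have "eps * Lmax lam m0 * (real m0 / ((1 + 1/d) * L)) \<le> eps * (L * Lbar lam m0) * (real m0 / ((1 + 1/d) * L))"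
      using Lmax_le_Lbar[OF m0(1)] eps_pos d1 L_ge_1 by (intro mult_right_mono mult_left_mono) auto
    also have "\<dots> = eps * real m0 * Lbar lam m0 / (1 + 1/d)" using L_ge_1 by simp
    also note S
    finally have "real m0 / ((1 + 1/d) * L) \<le> (\<Sum>j=1..m0. ?s j) / (eps * Lmax lam m0)"
      using oracle_variance_pos by (simp add: le_divide_eq mult_ac)
    then have "real m0 / ((1 + 1/d) * L) / 5 \<le> (\<Sum>j=1..m0. ?s j) / (eps * Lmax lam m0) / 5"
      by (rule divide_right_mono) simp
    then show ?thesis by (simp add: mult_ac)
  qed
  finally show ?thesis .
qed

end

section \<open>The hierarchical posterior\<close>

lemma sqnorm_diff_measurable:
  "(\<lambda>x. sqnorm (\<lambda>j. x j - theta j)) \<in> borel_measurable (PiM UNIV (\<lambda>_. borel))"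
  unfolding sqnorm_def by measurable

context sieve_model
begin

definition target :: "(nat \<Rightarrow> real) set" where
  "target = {x. Phi0 / K \<le> sqnorm (\<lambda>j. x j - theta j) \<and> sqnorm (\<lambda>j. x j - theta j) \<le> K * Phi0}"

lemma target_sets: "target \<in> sets (PiM UNIV (\<lambda>_. borel))"
proof -
  note [measurable] = sqnorm_diff_measurable[of theta]
  have "{x \<in> space (PiM UNIV (\<lambda>_. borel)). Phi0 / K \<le> sqnorm (\<lambda>j. x j - theta j)
      \<and> sqnorm (\<lambda>j. x j - theta j) \<le> K * Phi0} \<in> sets (PiM UNIV (\<lambda>_. borel))"
    by measurable
  then show ?thesis by (simp add: target_def space_PiM)
qed

lemma thetaY_measurable [measurable]:
  "(\<lambda>Y. thetaY lam eta tau eps Y j) \<in> borel_measurable (PiM UNIV (\<lambda>_. borel))"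
  unfolding thetaY_def by measurable

text \<open>Joint measurability in data and noise makes the measure of each noise section, hence
  each sieve posterior probability, measurable in the data.\<close>

lemma draw_measurable:
  "(\<lambda>(Y, w). draw m Y w) \<in> measurable (PiM UNIV (\<lambda>_. borel) \<Otimes>\<^sub>M white_noise) (PiM UNIV (\<lambda>_. borel))"
proof -
  have "(\<lambda>p. draw m (fst p) (snd p) j) \<in> borel_measurable (PiM UNIV (\<lambda>_. borel) \<Otimes>\<^sub>M white_noise)" for j
    unfolding draw_def by (cases "1 \<le> j \<and> j \<le> m") (simp_all, measurable)
  then show ?thesis
    unfolding split_beta by (intro measurable_PiM_single') (auto simp: space_PiM)
qed

lemma draw_measurable2: "draw m Y \<in> measurable white_noise (PiM UNIV (\<lambda>_. borel))"
  using measurable_compose[OF measurable_Pair1' draw_measurable[of m], of Y]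
  by (simp add: space_PiM)

lemma measure_sieve_post:
  "measure (sieve_post lam eta tau eps m Y) target = measure white_noise {w. draw m Y w \<in> target}"
  unfolding sieve_post_eq using target_sets
  by (subst measure_distr[OF draw_measurable2]) (auto simp: vimage_def)

lemma measure_sieve_post_measurable:
  "(\<lambda>Y. measure (sieve_post lam eta tau eps m Y) target) \<in> borel_measurable (PiM UNIV (\<lambda>_. borel))"
proof -
  interpret W: prob_space white_noise by (rule prob_space_white_noise)
  let ?Q = "(\<lambda>(Y, w). draw m Y w) -` target \<inter> space (PiM UNIV (\<lambda>_. borel) \<Otimes>\<^sub>M white_noise)"
  have "?Q \<in> sets (PiM UNIV (\<lambda>_. borel) \<Otimes>\<^sub>M white_noise)"
    by (rule measurable_sets[OF draw_measurable target_sets])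
  then have "(\<lambda>Y. emeasure white_noise (Pair Y -` ?Q)) \<in> borel_measurable (PiM UNIV (\<lambda>_. borel))"
    by (rule W.measurable_emeasure_Pair)
  then have "(\<lambda>Y. enn2real (emeasure white_noise (Pair Y -` ?Q))) \<in> borel_measurable (PiM UNIV (\<lambda>_. borel))"
    by measurable
  moreover have "Pair Y -` ?Q = {w. draw m Y w \<in> target}" for Y
    by (auto simp: space_pair_measure space_PiM)
  ultimately show ?thesis unfolding measure_sieve_post by (simp add: measure_def)
qed

lemma post_exponent_measurable [measurable]:
  "(\<lambda>Y. post_exponent lam eta tau eps C m Y) \<in> borel_measurable (PiM UNIV (\<lambda>_. borel))"
  unfolding post_exponent_def by measurable

lemma postM_measurable [measurable]:
  "(\<lambda>Y. postM lam eta tau eps C m Y) \<in> borel_measurable (PiM UNIV (\<lambda>_. borel))"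
  unfolding postM_def by measurable

lemma hier_post_prob_measurable:
  "(\<lambda>Y. hier_post_prob lam eta tau eps C Y target) \<in> borel_measurable (PiM UNIV (\<lambda>_. borel))"
  unfolding hier_post_prob_def
  using measure_sieve_post_measurable postM_measurable by (intro borel_measurable_sum borel_measurable_times)

section \<open>Bad dimensions and the expected posterior mass\<close>

definition badM :: "nat set" where
  "badM = {m \<in> {1..Gdim lam eps}.
     D * m0 < m \<or> (m < m0 \<and> 8 * L * C * (1 + 1/d) * Phi0 < bias theta eta m)}"

text \<open>Supplies the two dimension conditions of \<open>sqnorm_draw_le\<close>. For
  \<open>m \<ge> m0\<close> the bias is at most \<open>Phi0\<close> by monotonicity.\<close>

lemma bias_le_if_not_bad:
  assumes "m \<in> {1..Gdim lam eps} - badM"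
  shows "m \<le> D * m0" "bias theta eta m \<le> 8 * L * C * (1 + 1/d) * Phi0"
proof -
  show "m \<le> D * m0" using assms by (auto simp: badM_def)
  show "bias theta eta m \<le> 8 * L * C * (1 + 1/d) * Phi0"
  proof (cases "m < m0")
    case True
    then show ?thesis using assms by (auto simp: badM_def)
  next
    case False
    have "1 * 1 * 1 * 1 \<le> 8 * L * C * (1 + 1/d)"
      using L_ge_1 C_ge_1 d_pos by (intro mult_mono) auto
    then have "1 * Phi0 \<le> 8 * L * C * (1 + 1/d) * Phi0" using Phi0_pos by (intro mult_right_mono) auto
    then show ?thesis using bias_antimono[of m0 m] False oracle_upper(1) by simp
  qed
qed

text \<open>For typical data a draw misses \<open>target\<close> only if its own chi-square sum is
  large or it falls into the small ball; the two exponentials match these cases.\<close>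

lemma sieve_post_target_ge:
  assumes m: "m \<in> {1..Gdim lam eps} - badM"
    and z: "(\<Sum>j=1..D * m0. (z j)\<^sup>2) < 3/2 * real (D * m0)"
  shows "1 - (exp (- real m0 / 40) + exp (- real m0 / (5 * (1 + 1/d) * L)))
    \<le> measure (sieve_post lam eta tau eps m (obs z)) target"
proof -
  interpret W: prob_space white_noise by (rule prob_space_white_noise)
  let ?A = "{w. 3/2 * real (D * m0) \<le> (\<Sum>j=1..D * m0. (w j :: real)\<^sup>2)}"
    and ?B = "{w. sqnorm (\<lambda>j. draw m (obs z) w j - theta j) < Phi0 / K}"
    and ?T = "{w. draw m (obs z) w \<in> target}"
  have "{w \<in> space white_noise. 3/2 * real (D * m0) \<le> (\<Sum>j=1..D * m0. (w j :: real)\<^sup>2)} \<in> sets white_noise"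
    by measurable
  then have A: "?A \<in> sets white_noise" by simp
  have sq: "(\<lambda>w. sqnorm (\<lambda>j. draw m (obs z) w j - theta j)) \<in> borel_measurable white_noise"
    by (rule measurable_compose[OF draw_measurable2 sqnorm_diff_measurable])
  have "{w \<in> space white_noise. sqnorm (\<lambda>j. draw m (obs z) w j - theta j) < Phi0 / K} \<in> sets white_noise"
    using sq by measurable
  then have B: "?B \<in> sets white_noise" by simp
  have T: "?T \<in> sets white_noise"
    using measurable_sets[OF draw_measurable2 target_sets, of m "obs z"] by (simp add: vimage_def)
  have m': "1 \<le> m" "m \<le> Gdim lam eps" using m by auto
  have sub: "- ?T \<subseteq> ?A \<union> ?B"
  proof
    fix w assume w: "w \<in> - ?T"
    show "w \<in> ?A \<union> ?B"
    proof (cases "w \<in> ?B")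
      case False
      with w have "\<not> sqnorm (\<lambda>j. draw m (obs z) w j - theta j) \<le> K * Phi0"
        by (auto simp: target_def)
      then have "\<not> (\<Sum>j=1..D * m0. (w j)\<^sup>2) < 3/2 * real (D * m0)"
        using sqnorm_draw_le[OF bias_le_if_not_bad(1)[OF m] m'(2) bias_le_if_not_bad(2)[OF m] z, of w]
        by blast
      then show ?thesis by simp
    qed simp
  qed
  have "1 - W.prob ?T = W.prob (- ?T)"
    using W.prob_compl[OF T] by (simp add: Compl_eq_Diff_UNIV)
  also have "\<dots> \<le> W.prob (?A \<union> ?B)" using sub A B by (intro W.finite_measure_mono) auto
  also have "\<dots> \<le> W.prob ?A + W.prob ?B" using A B by (rule measure_Un_le)
  also have "\<dots> \<le> exp (- real m0 / 40) + exp (- real m0 / (5 * (1 + 1/d) * L))"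
  proof (rule add_mono)
    have "1 * real m0 \<le> real D * real m0" using D_ge_1 by (intro mult_right_mono) auto
    then have "exp (- real (D * m0) / 40) \<le> exp (- real m0 / 40)" by simp
    then show "W.prob ?A \<le> exp (- real m0 / 40)"
      using chi_square_upper_tail[of "D * m0"] by (rule order_trans[rotated])
    show "W.prob ?B \<le> exp (- real m0 / (5 * (1 + 1/d) * L))" by (rule draw_small_ball[OF m'])
  qed
  finally show ?thesis unfolding measure_sieve_post by simp
qed

lemma integral_postM_bad:
  assumes "m \<in> badM"
  shows "(\<integral>z. postM lam eta tau eps C m (obs z) \<partial>white_noise) \<le> exp (- real m0 / 5)"
    and "integrable white_noise (\<lambda>z. postM lam eta tau eps C m (obs z))"
proof -
  interpret W: prob_space white_noise by (rule prob_space_white_noise)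
  have m: "1 \<le> m" "m \<le> Gdim lam eps" using assms by (auto simp: badM_def)
  have meas: "(\<lambda>z. postM lam eta tau eps C m (obs z)) \<in> borel_measurable white_noise"
    by (rule measurable_compose[OF obs_measurable postM_measurable])
  show int: "integrable white_noise (\<lambda>z. postM lam eta tau eps C m (obs z))"
    using meas postM_nonneg postM_le_1[OF m]
    by (intro W.integrable_const_bound[where B=1]) auto
  have "ennreal (\<integral>z. postM lam eta tau eps C m (obs z) \<partial>white_noise)
      = (\<integral>\<^sup>+z. ennreal (postM lam eta tau eps C m (obs z)) \<partial>white_noise)"
    using int postM_nonneg by (intro nn_integral_eq_integral[symmetric]) auto
  also have "\<dots> \<le> ennreal (exp (- real m0 / 5))"
    using assms postM_underfit[of m] postM_overfit[of m] m by (auto simp: badM_def)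
  finally show "(\<integral>z. postM lam eta tau eps C m (obs z) \<partial>white_noise) \<le> exp (- real m0 / 5)"
    by simp
qed

lemma hier_post_prob_bounds: "0 \<le> hier_post_prob lam eta tau eps C Y target"
  "hier_post_prob lam eta tau eps C Y target \<le> 1"
proof -
  have p: "0 \<le> measure (sieve_post lam eta tau eps m Y) target"
    "measure (sieve_post lam eta tau eps m Y) target \<le> 1" for m
    unfolding measure_sieve_post using prob_space.prob_le_1[OF prob_space_white_noise] by auto
  show "0 \<le> hier_post_prob lam eta tau eps C Y target"
    unfolding hier_post_prob_def using p postM_nonneg by (intro sum_nonneg mult_nonneg_nonneg)
  have "hier_post_prob lam eta tau eps C Y target \<le> (\<Sum>m=1..Gdim lam eps. postM lam eta tau eps C m Y * 1)"
    unfolding hier_post_prob_def using p postM_nonneg by (intro sum_mono mult_left_mono)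
  then show "hier_post_prob lam eta tau eps C Y target \<le> 1" using sum_postM by simp
qed

lemma expected_posterior_bounds:
  shows "1 - (real (Gdim lam eps) * exp (- real m0 / 5) + 2 * exp (- real m0 / 40)
            + exp (- real m0 / (5 * (1 + 1/d) * L)))
    \<le> (\<integral>Y. hier_post_prob lam eta tau eps C Y target \<partial>data_law lam theta eps)" (is "?lower")
    and "(\<integral>Y. hier_post_prob lam eta tau eps C Y target \<partial>data_law lam theta eps) \<le> 1" (is "?upper")
proof -
  interpret W: prob_space white_noise by (rule prob_space_white_noise)
  have prob_UNIV: "W.prob UNIV = 1" using W.prob_space by simp
  let ?H = "\<lambda>z. hier_post_prob lam eta tau eps C (obs z) target"
  let ?p = "\<lambda>m z. postM lam eta tau eps C m (obs z)"
  let ?e = "exp (- real m0 / 40) + exp (- real m0 / (5 * (1 + 1/d) * L))"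
  let ?A = "{z. 3/2 * real (D * m0) \<le> (\<Sum>j=1..D * m0. (z j :: real)\<^sup>2)}"
  have eq: "(\<integral>Y. hier_post_prob lam eta tau eps C Y target \<partial>data_law lam theta eps) = (\<integral>z. ?H z \<partial>white_noise)"
    unfolding data_law_eq by (rule integral_distr[OF obs_measurable hier_post_prob_measurable])
  have Hm: "?H \<in> borel_measurable white_noise"
    by (rule measurable_compose[OF obs_measurable hier_post_prob_measurable])
  have Hi: "integrable white_noise ?H"
    using Hm hier_post_prob_bounds by (intro W.integrable_const_bound[where B=1]) auto
  have "(\<integral>z. ?H z \<partial>white_noise) \<le> (\<integral>z. 1 \<partial>white_noise)"
    using Hi hier_post_prob_bounds by (intro integral_mono) auto
  then show ?upper unfolding eq by (simp add: prob_UNIV)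
  have "{z \<in> space white_noise. 3/2 * real (D * m0) \<le> (\<Sum>j=1..D * m0. (z j :: real)\<^sup>2)} \<in> sets white_noise"
    by measurable
  then have A: "?A \<in> sets white_noise" by simp
  have fin: "finite badM" and bad: "badM \<subseteq> {1..Gdim lam eps}" by (auto simp: badM_def)
  \<comment> \<open>Missing posterior mass is charged to the weight of bad dimensions, to
    exceptional data (trivial bound 1), or to the failure probability \<open>?e\<close> of a draw.
    The chi-square tail enters once for the data and once for the draw, whence the coefficient
    2.\<close>
  have pt: "1 - ?H z \<le> (\<Sum>m\<in>badM. ?p m z) + indicator ?A z + ?e" for z
  proof (cases "z \<in> ?A")
    case True
    have "0 \<le> (\<Sum>m\<in>badM. ?p m z)" using postM_nonneg by (intro sum_nonneg) auto
    moreover have "0 \<le> ?e" by (intro add_nonneg_nonneg) auto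
    moreover have "indicator ?A z = (1 :: real)" using True by simp
    ultimately show ?thesis using hier_post_prob_bounds(1)[of "obs z"] by linarith
  next
    case False
    then have z: "(\<Sum>j=1..D * m0. (z j)\<^sup>2) < 3/2 * real (D * m0)" by simp
    let ?q = "\<lambda>m. measure (sieve_post lam eta tau eps m (obs z)) target"
    have split: "(\<Sum>m=1..Gdim lam eps. f m) = (\<Sum>m\<in>badM. f m) + (\<Sum>m\<in>{1..Gdim lam eps} - badM. f m)"
      for f :: "nat \<Rightarrow> real"
      using sum.subset_diff[OF bad, of f] by simp
    have q0: "0 \<le> ?q m" for m by simp
    have "1 - ?H z = (\<Sum>m=1..Gdim lam eps. ?p m z * (1 - ?q m))"
      using sum_postM[of "obs z"] by (simp add: hier_post_prob_def right_diff_distrib sum_subtractf)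
    also have "\<dots> = (\<Sum>m\<in>badM. ?p m z * (1 - ?q m)) + (\<Sum>m\<in>{1..Gdim lam eps} - badM. ?p m z * (1 - ?q m))"
      by (rule split)
    also have "\<dots> \<le> (\<Sum>m\<in>badM. ?p m z * 1) + (\<Sum>m\<in>{1..Gdim lam eps} - badM. ?p m z * ?e)"
    proof (intro add_mono sum_mono mult_left_mono postM_nonneg)
      fix m assume "m \<in> {1..Gdim lam eps} - badM"
      from sieve_post_target_ge[OF this z] show "1 - ?q m \<le> ?e" by linarith
    qed (use q0 in auto)
    also have "(\<Sum>m\<in>{1..Gdim lam eps} - badM. ?p m z * ?e) \<le> (\<Sum>m=1..Gdim lam eps. ?p m z * ?e)"
      using postM_nonneg by (intro sum_mono2) (auto intro!: mult_nonneg_nonneg add_nonneg_nonneg)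
    also have "\<dots> = ?e" using sum_postM[of "obs z"] by (simp add: sum_distrib_right[symmetric])
    finally show ?thesis using False by simp
  qed
  have "1 - (\<integral>z. ?H z \<partial>white_noise) = (\<integral>z. 1 - ?H z \<partial>white_noise)"
    using Hi by (simp add: prob_UNIV)
  also have "\<dots> \<le> (\<integral>z. (\<Sum>m\<in>badM. ?p m z) + indicator ?A z + ?e \<partial>white_noise)"
    using Hi A integral_postM_bad(2) pt by (intro integral_mono) (auto simp: W.emeasure_eq_measure)
  also have "\<dots> = (\<Sum>m\<in>badM. \<integral>z. ?p m z \<partial>white_noise) + W.prob ?A + ?e"
    using A integral_postM_bad(2) by (simp add: W.emeasure_eq_measure prob_UNIV)
  also have "\<dots> \<le> real (Gdim lam eps) * exp (- real m0 / 5) + exp (- real m0 / 40) + ?e"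
  proof (intro add_mono order_refl)
    have "(\<Sum>m\<in>badM. \<integral>z. ?p m z \<partial>white_noise) \<le> real (card badM) * exp (- real m0 / 5)"
      using integral_postM_bad(1) by (intro sum_bounded_above) auto
    also have "\<dots> \<le> real (Gdim lam eps) * exp (- real m0 / 5)"
      using card_mono[OF _ bad] by (intro mult_right_mono) auto
    finally show "(\<Sum>m\<in>badM. \<integral>z. ?p m z \<partial>white_noise) \<le> real (Gdim lam eps) * exp (- real m0 / 5)" .
    have "1 * real m0 \<le> real D * real m0" using D_ge_1 by (intro mult_right_mono) auto
    then have "exp (- real (D * m0) / 40) \<le> exp (- real m0 / 40)" by simp
    then show "W.prob ?A \<le> exp (- real m0 / 40)"
      using chi_square_upper_tail[of "D * m0"] by (rule order_trans[rotated])
  qed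
  finally show ?lower unfolding eq by simp
qed

end

section \<open>Asymptotics of the oracle\<close>

context sequence_model
begin

lemma Lbar_ge: "1 \<le> m \<Longrightarrow> 1 / L \<le> Lbar lam m"
  using Lmax_le_Lbar[of m] Lmax_ge_1[of m] L_ge_1 by (simp add: divide_le_eq mult.commute)

lemma Phi_nonneg: "0 \<le> Phi lam theta eta eps m"
  unfolding Phi_def by (intro max.coboundedI1 bias_nonneg)

lemma Phi_ge:
  assumes "0 < eps" "1 \<le> m"
  shows "eps * real m / L \<le> Phi lam theta eta eps m"
proof -
  have "eps * real m * (1 / L) \<le> eps * real m * Lbar lam m"
    using assms Lbar_ge by (intro mult_left_mono) auto
  then show ?thesis by (simp add: Phi_def)
qed

text \<open>\<open>Phi\<close> grows at least linearly in \<open>m\<close>, so beyond some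
  \<open>N\<close> it exceeds its value at 1 and a minimum over \<open>{1..N}\<close> is global.
  Hence the \<open>LEAST\<close> in \<open>mo\<close> is meaningful and the \<open>INF\<close> in
  \<open>Phio\<close> is attained.\<close>

lemma Phi_minimizer_exists:
  assumes eps: "0 < eps"
  shows "\<exists>m\<ge>1. \<forall>k\<ge>1. Phi lam theta eta eps m \<le> Phi lam theta eta eps k"
proof -
  let ?P = "Phi lam theta eta eps"
  obtain N :: nat where N: "L * ?P 1 / eps < real N" using reals_Archimedean2 by blast
  have "0 \<le> L * ?P 1 / eps" using L_ge_1 Phi_nonneg[of eps 1] eps by simp
  then have N1: "1 \<le> N" using N by (cases N) auto
  obtain m where m: "m \<in> {1..N}" "\<forall>k\<in>{1..N}. ?P m \<le> ?P k"
    using ex_is_arg_min_if_finite[of "{1..N}" ?P] N1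
    by (auto simp: is_arg_min_linorder)
  have "?P m \<le> ?P k" if k: "1 \<le> k" for k
  proof (cases "k \<le> N")
    case True
    then show ?thesis using m k by auto
  next
    case False
    have "?P m \<le> ?P 1" using m N1 by auto
    also have "L * ?P 1 < eps * real N" using N eps by (simp add: divide_less_eq mult.commute)
    then have "?P 1 < eps * real N / L" using L_ge_1 by (simp add: less_divide_eq mult.commute)
    also have "\<dots> \<le> eps * real k / L" using False eps L_ge_1 by (intro divide_right_mono mult_left_mono) auto
    also have "\<dots> \<le> ?P k" by (rule Phi_ge[OF eps k])
    finally show ?thesis by simp
  qed
  then show ?thesis using m by auto
qed

lemma mo_minimal:
  assumes "0 < eps"
  shows "1 \<le> mo lam theta eta eps"
    "1 \<le> k \<Longrightarrow> Phi lam theta eta eps (mo lam theta eta eps) \<le> Phi lam theta eta eps k"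
proof -
  have "1 \<le> mo lam theta eta eps \<and>
      (\<forall>k\<ge>1. Phi lam theta eta eps (mo lam theta eta eps) \<le> Phi lam theta eta eps k)"
    unfolding mo_def by (rule LeastI_ex[OF Phi_minimizer_exists[OF assms]])
  then show "1 \<le> mo lam theta eta eps"
    "1 \<le> k \<Longrightarrow> Phi lam theta eta eps (mo lam theta eta eps) \<le> Phi lam theta eta eps k" by auto
qed

lemma Phio_eq:
  assumes "0 < eps"
  shows "Phio lam theta eta eps = Phi lam theta eta eps (mo lam theta eta eps)"
  unfolding Phio_def using mo_minimal[OF assms]
  by (intro cInf_eq_minimum) auto

lemma Phio_pos:
  assumes "0 < eps"
  shows "0 < Phio lam theta eta eps"
proof -
  have "0 < eps * real (mo lam theta eta eps) / L"
    using assms mo_minimal(1)[OF assms] L_ge_1 by simp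
  also have "\<dots> \<le> Phio lam theta eta eps"
    unfolding Phio_eq[OF assms] by (intro Phi_ge assms mo_minimal)
  finally show ?thesis .
qed

lemma Phio_bounds:
  assumes "0 < eps"
  shows "bias theta eta (mo lam theta eta eps) \<le> Phio lam theta eta eps"
    "eps * real (mo lam theta eta eps) * Lbar lam (mo lam theta eta eps) \<le> Phio lam theta eta eps"
  unfolding Phio_eq[OF assms] by (auto simp: Phi_def)

lemma kappa_o_le:
  assumes "0 < eps" "eps < eps_o"
  shows "kappa_o lam theta eta eps_o \<le>
     min (bias theta eta (mo lam theta eta eps))
         (eps * real (mo lam theta eta eps) * Lbar lam (mo lam theta eta eps)) / Phio lam theta eta eps"
  unfolding kappa_o_def
proof (rule cINF_lower)
  \<comment> \<open>A real \<open>INF\<close> is known to be a lower bound only for a family bounded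
    below; here 0 serves.\<close>
  show "bdd_below ((\<lambda>eps. min (bias theta eta (mo lam theta eta eps))
       (eps * real (mo lam theta eta eps) * Lbar lam (mo lam theta eta eps)) / Phio lam theta eta eps) ` {0<..<eps_o})"
  proof (intro bdd_belowI2[where m=0] divide_nonneg_nonneg)
    fix e assume e: "e \<in> {0<..<eps_o}"
    then show "0 \<le> min (bias theta eta (mo lam theta eta e))
       (e * real (mo lam theta eta e) * Lbar lam (mo lam theta eta e))"
      using bias_nonneg Lbar_pos[OF mo_minimal(1), of e] by simp
    show "0 \<le> Phio lam theta eta e" using Phio_pos[of e] e by simp
  qed
qed (use assms in auto)

lemma kappa_o_bounds:
  assumes "0 < eps" "eps < eps_o"
  shows "kappa_o lam theta eta eps_o \<le> 1"
    "kappa_o lam theta eta eps_o * Phio lam theta eta eps \<le> bias theta eta (mo lam theta eta eps)"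
    "kappa_o lam theta eta eps_o * Phio lam theta eta eps
      \<le> eps * real (mo lam theta eta eps) * Lbar lam (mo lam theta eta eps)"
proof -
  let ?x = "min (bias theta eta (mo lam theta eta eps))
         (eps * real (mo lam theta eta eps) * Lbar lam (mo lam theta eta eps))"
  have "kappa_o lam theta eta eps_o * Phio lam theta eta eps \<le> ?x"
    using kappa_o_le[OF assms] Phio_pos[OF assms(1)] by (simp only: le_divide_eq if_True)
  then show "kappa_o lam theta eta eps_o * Phio lam theta eta eps \<le> bias theta eta (mo lam theta eta eps)"
    "kappa_o lam theta eta eps_o * Phio lam theta eta eps
      \<le> eps * real (mo lam theta eta eps) * Lbar lam (mo lam theta eta eps)" by auto
  have "?x / Phio lam theta eta eps \<le> 1"
    using Phio_bounds[OF assms(1)] Phio_pos[OF assms(1)] by (simp add: divide_le_eq)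
  then show "kappa_o lam theta eta eps_o \<le> 1" using kappa_o_le[OF assms] by linarith
qed

text \<open>First fix a dimension \<open>k\<close> with small tail bias, then let \<open>eps\<close>
  shrink the variance term at \<open>k\<close>; the oracle rate lies below \<open>Phi\<close> at
  \<open>k\<close>.\<close>

lemma eventually_Phio_less:
  assumes "0 < r"
  shows "\<forall>\<^sub>F eps in at_right 0. Phio lam theta eta eps < r"
proof -
  obtain N where N: "\<forall>n\<ge>N. norm (\<Sum>i. (theta (Suc (i + n)) - eta (Suc (i + n)))\<^sup>2) < r"
    using suminf_exist_split[OF assms diff_l2] by auto
  define k where "k = Suc N"
  have b: "bias theta eta k < r" using N[rule_format, of k] by (simp add: bias_def k_def)
  have "((\<lambda>eps. eps * real k * Lbar lam k) \<longlongrightarrow> 0 * real k * Lbar lam k) (at_right 0)"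
    by (intro tendsto_intros)
  then have "\<forall>\<^sub>F eps in at_right 0. eps * real k * Lbar lam k < r"
    using assms by (intro order_tendstoD(2)) auto
  moreover have "\<forall>\<^sub>F eps in at_right 0. 0 < (eps::real)" by (rule eventually_at_right_less)
  ultimately show ?thesis
  proof eventually_elim
    case (elim eps)
    have "Phio lam theta eta eps \<le> Phi lam theta eta eps k"
      unfolding Phio_eq[OF elim(2)] by (rule mo_minimal(2)[OF elim(2)]) (simp add: k_def)
    also have "\<dots> < r" using b elim by (simp add: Phi_def)
    finally show ?case .
  qed
qed

lemma le_Gdim:
  assumes "0 < eps" "1 \<le> m" "eps * real m \<le> 1" "eps * Lmax lam m \<le> Lam lam 1"
  shows "m \<le> Gdim lam eps"
proof -
  have "real m \<le> 1 / eps" using assms by (simp add: le_divide_eq mult.commute)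
  then have "m \<le> nat \<lfloor>1 / eps\<rfloor>" by (simp add: le_nat_floor)
  then show ?thesis unfolding Gdim_def using assms
    by (intro Max_ge) (auto intro: finite_subset[of _ "{..nat \<lfloor>1 / eps\<rfloor>}"])
qed

text \<open>Once the rate is below \<open>1 / L\<close>, both \<open>eps * m\<close> and
  \<open>eps * Lmax lam m\<close> at the oracle are at most \<open>L\<close> times the rate, hence
  at most 1, and \<open>1 \<le> Lam lam 1\<close>.\<close>

lemma eventually_mo_le_Gdim: "\<forall>\<^sub>F eps in at_right 0. mo lam theta eta eps \<le> Gdim lam eps"
proof -
  have r: "0 < 1 / L" using L_ge_1 by simp
  have "\<forall>\<^sub>F eps in at_right 0. 0 < (eps::real)" by (rule eventually_at_right_less)
  with eventually_Phio_less[OF r] show ?thesis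
  proof eventually_elim
    case (elim eps)
    let ?m = "mo lam theta eta eps"
    have m: "1 \<le> ?m" by (rule mo_minimal(1)[OF elim(2)])
    show ?case
    proof (rule le_Gdim[OF elim(2) m])
      have "eps * real ?m / L \<le> 1 / L"
        using Phi_ge[OF elim(2) m] elim(1) Phio_eq[OF elim(2)] by simp
      then show "eps * real ?m \<le> 1" using L_ge_1 by (simp add: divide_le_cancel)
      have "eps * Lmax lam ?m \<le> eps * (L * Lbar lam ?m)"
        using Lmax_le_Lbar[OF m] elim(2) by (intro mult_left_mono) auto
      also have "\<dots> = 1 * (L * (eps * Lbar lam ?m))" by simp
      also have "\<dots> \<le> real ?m * (L * (eps * Lbar lam ?m))"
        using m L_ge_1 elim(2) Lbar_pos[OF m] by (intro mult_right_mono) auto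
      also have "\<dots> = L * (eps * real ?m * Lbar lam ?m)" by simp
      also have "\<dots> \<le> L * Phio lam theta eta eps"
        using Phio_bounds(2)[OF elim(2)] L_ge_1 by (intro mult_left_mono) auto
      also have "\<dots> \<le> 1" using elim(1) L_ge_1 by (simp add: less_divide_eq mult.commute)
      also have "\<dots> \<le> Lam lam 1" using Lmax_ge_1[of 1] by simp
      finally show "eps * Lmax lam ?m \<le> Lam lam 1" .
    qed
  qed
qed

text \<open>Each fixed dimension meets both constraints of \<open>Gdim\<close> once
  \<open>eps\<close> is small.\<close>

lemma filterlim_Gdim: "filterlim (\<lambda>eps. real (Gdim lam eps)) at_top (at_right 0)"
  unfolding filterlim_at_top
proof
  fix Z :: real
  obtain N :: nat where N: "Z \<le> real N" using real_arch_simple by blast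
  define m where "m = Suc N"
  have "((\<lambda>eps. eps * real m) \<longlongrightarrow> 0 * real m) (at_right 0)"
    "((\<lambda>eps. eps * Lmax lam m) \<longlongrightarrow> 0 * Lmax lam m) (at_right 0)"
    by (rule tendsto_mult_right[OF tendsto_ident_at])+
  then have "\<forall>\<^sub>F eps in at_right 0. eps * real m < 1" "\<forall>\<^sub>F eps in at_right 0. eps * Lmax lam m < Lam lam 1"
    using Lam_pos[of 1] by (auto intro!: order_tendstoD(2))
  moreover have "\<forall>\<^sub>F eps in at_right 0. 0 < (eps::real)" by (rule eventually_at_right_less)
  ultimately show "\<forall>\<^sub>F eps in at_right 0. Z \<le> real (Gdim lam eps)"
  proof eventually_elim
    case (elim eps)
    have "m \<le> Gdim lam eps" using elim by (intro le_Gdim) (auto simp: m_def)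
    then show ?case using N by (simp add: m_def)
  qed
qed

end

section \<open>Passage to the limit\<close>

lemma tendsto_exp_neg_div:
  assumes "filterlim f at_top F" "0 < (c::real)"
  shows "((\<lambda>x. exp (- f x / c)) \<longlongrightarrow> 0) F"
proof -
  have "filterlim (\<lambda>x. inverse c * f x) at_top F"
    using assms by (intro filterlim_tendsto_pos_mult_at_top[OF tendsto_const]) auto
  then have "filterlim (\<lambda>x. - f x / c) at_bot F"
    by (simp add: filterlim_uminus_at_bot field_simps)
  then show ?thesis by (rule filterlim_compose[OF exp_at_bot])
qed

theorem mainTheorem13:
  fixes lam eta theta :: "nat \<Rightarrow> real" and tau :: "real \<Rightarrow> nat \<Rightarrow> real"
    and d C L eps_o :: real
  assumes lam_bounded: "\<exists>B. \<forall>j. \<bar>lam j\<bar> \<le> B"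
    and lam_nonzero: "\<forall>j\<ge>1. lam j \<noteq> 0"
    and theta_l2: "summable (\<lambda>j. (theta (Suc j))^2)"
    and diff_l2: "summable (\<lambda>j. (theta (Suc j) - eta (Suc j))^2)"
    and tau_pos: "\<forall>eps j. 0 < eps \<and> eps < 1 \<and> 1 \<le> j \<longrightarrow> 0 < tau eps j"
    and eps_o: "0 < eps_o" "eps_o < 1"
    and A_d: "d > 0"
    and A: "\<forall>eps. 0 < eps \<and> eps < 1 \<longrightarrow> (\<forall>j\<in>{1..Gdim lam eps}.
              d * max (sqrt (eps * Lam lam j)) (eps * Lam lam j) \<le> tau eps j)"
    and E_C: "C \<ge> 1" and E_L: "L \<ge> 1"
    and E_i: "\<forall>k\<ge>1. \<forall>j>k. (lam j)^2 \<le> C * Min ((\<lambda>i. (lam i)^2) ` {1..k})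
                              \<and> Min ((\<lambda>i. (lam i)^2) ` {1..k}) = 1 / Lmax lam k"
    and E_ii: "\<forall>k\<ge>1. \<forall>l\<ge>1. Lmax lam (k * l) \<le> Lmax lam k * Lmax lam l"
    and E_iii: "\<forall>k\<ge>1. Lmax lam k / Lbar lam k \<le> L"
    and O: "kappa_o lam theta eta eps_o > 0"
    and rate: "((\<lambda>eps. ln (real (Gdim lam eps)) / real (mo lam theta eta eps)) \<longlongrightarrow> 0) (at_right 0)"
  shows "((\<lambda>eps. \<integral>Y. hier_post_prob lam eta (tau eps) eps C Y
              {x. Phio lam theta eta eps / Ko lam theta eta eps_o d C L
                    \<le> sqnorm (\<lambda>j. x j - theta j)
                  \<and> sqnorm (\<lambda>j. x j - theta j)
                    \<le> Ko lam theta eta eps_o d C L * Phio lam theta eta eps}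
            \<partial>data_law lam theta eps) \<longlongrightarrow> 1) (at_right 0)"
proof -
  interpret sequence_model lam eta theta C L
  proof
    show "(lam j)\<^sup>2 \<le> C / Lmax lam k" if "1 \<le> k" "k < j" for k j
    proof -
      have "(lam j)\<^sup>2 \<le> C * Min ((\<lambda>i. (lam i)\<^sup>2) ` {1..k})
          \<and> Min ((\<lambda>i. (lam i)\<^sup>2) ` {1..k}) = 1 / Lmax lam k"
        using E_i that by blast
      then show ?thesis by (metis times_divide_eq_right mult.right_neutral)
    qed
  qed (use lam_nonzero diff_l2 E_C E_L E_ii E_iii in auto)
  let ?m = "mo lam theta eta" and ?G = "Gdim lam"
  let ?I = "\<lambda>eps. \<integral>Y. hier_post_prob lam eta (tau eps) eps C Y
              {x. Phio lam theta eta eps / Ko lam theta eta eps_o d C L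
                    \<le> sqnorm (\<lambda>j. x j - theta j)
                  \<and> sqnorm (\<lambda>j. x j - theta j)
                    \<le> Ko lam theta eta eps_o d C L * Phio lam theta eta eps}
            \<partial>data_law lam theta eps"
  have small: "\<forall>\<^sub>F eps in at_right 0. 0 < eps \<and> eps < eps_o"
    using eventually_at_right_real[OF eps_o(1)] by simp
  \<comment> \<open>Used with \<open>r = 1\<close> to make the oracle dimension diverge and with
    \<open>r = 1/10\<close> to absorb the sum over up to \<open>G\<close> bad dimensions.\<close>
  have rate_less: "\<forall>\<^sub>F eps in at_right 0. ln (real (?G eps)) < r * real (?m eps)" if "0 < r" for r
    using order_tendstoD(2)[OF rate that] small
  proof eventually_elim
    case (elim eps)
    then show ?case using mo_minimal(1)[of eps] by (simp add: divide_less_eq)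
  qed
  have mo_top: "filterlim (\<lambda>eps. real (?m eps)) at_top (at_right 0)"
  proof (rule filterlim_at_top_mono)
    show "filterlim (\<lambda>eps. ln (real (?G eps))) at_top (at_right 0)"
      by (rule filterlim_compose[OF ln_at_top filterlim_Gdim])
    show "\<forall>\<^sub>F eps in at_right 0. ln (real (?G eps)) \<le> real (?m eps)"
      using rate_less[of 1] by (auto elim: eventually_mono)
  qed
  \<comment> \<open>The first term bounds \<open>G * exp (- m / 5)\<close> by means of
    \<open>G \<le> exp (m / 10)\<close>.\<close>
  let ?err = "\<lambda>eps. exp (- real (?m eps) / 10) + 2 * exp (- real (?m eps) / 40)
            + exp (- real (?m eps) / (5 * (1 + 1/d) * L))"
  have c: "0 < 5 * (1 + 1/d) * L" using A_d L_ge_1 by (intro mult_pos_pos) (auto simp: add_pos_pos)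
  have err: "((\<lambda>eps. 1 - ?err eps) \<longlongrightarrow> 1 - (0 + 2 * 0 + 0)) (at_right 0)"
    using c by (intro tendsto_intros tendsto_exp_neg_div mo_top) auto
  have bounds: "\<forall>\<^sub>F eps in at_right 0. 1 - ?err eps \<le> ?I eps \<and> ?I eps \<le> 1"
    using small eventually_mo_le_Gdim rate_less[of "1/10", simplified]
  proof eventually_elim
    case (elim eps)
    then have e: "0 < eps" "eps < eps_o" "eps < 1" using eps_o by auto
    \<comment> \<open>The restriction \<open>eps < eps_o\<close> yields the lower oracle bounds
      through \<open>kappa_o\<close>; the ceiling in \<open>Do\<close> yields the bound on
      \<open>D\<close>.\<close>
    interpret M: sieve_model lam eta theta C L "tau eps" eps d "kappa_o lam theta eta eps_o"
      "Phio lam theta eta eps" "?m eps" "Do lam theta eta eps_o L"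
    proof
      show "5 * L / kappa_o lam theta eta eps_o \<le> real (Do lam theta eta eps_o L)"
        unfolding Do_def by (rule real_nat_ceiling_ge)
    qed (use e tau_pos A A_d elim(2) O mo_minimal(1)[OF e(1)] Phio_bounds[OF e(1)]
        kappa_o_bounds[OF e(1,2)] in auto)
    have K: "M.K = Ko lam theta eta eps_o d C L" by (simp add: M.K_def Ko_def)
    have "real (?G eps) * exp (- real (?m eps) / 5) \<le> exp (real (?m eps) / 10) * exp (- real (?m eps) / 5)"
    proof (rule mult_right_mono)
      have "0 < real (?G eps)" using M.m0 by simp
      then have "real (?G eps) = exp (ln (real (?G eps)))" by simp
      also have "\<dots> \<le> exp (real (?m eps) / 10)" using elim(3) by simp
      finally show "real (?G eps) \<le> exp (real (?m eps) / 10)" .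
    qed simp
    also have "\<dots> = exp (- real (?m eps) / 10)" by (simp flip: exp_add)
    finally show ?case
      using M.expected_posterior_bounds unfolding M.target_def K by auto
  qed
  show ?thesis
  proof (rule tendsto_sandwich[where f="\<lambda>eps. 1 - ?err eps" and h="\<lambda>_. 1"])
    show "((\<lambda>eps. 1 - ?err eps) \<longlongrightarrow> 1) (at_right 0)" using err by simp
  qed (use bounds in \<open>auto elim: eventually_mono\<close>)
qed

end
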